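(* Let $\Psi:\overline{\mathbb D}\to\overline{\mathbb D}$ be a homeomorphism of class $C^1(\overline{\mathbb D})$ with identity boundary values ($\Psi|_{\mathbb T}=\operatorname{id}_{\mathbb T}$), where $C^1(\overline{\mathbb D})$ means that $\Psi$ has a $C^1$ extension to a neighborhood of $\overline{\mathbb D}$. Define $a_\Psi(\zeta)=\operatorname{Re}\bigl(\overline\zeta\,D\Psi(\zeta)[\zeta]\bigr)$ for $\zeta\in\mathbb T$. Then the following conditions are equivalent: (i) $\Psi|_{\mathbb D}\in\mathcal K_{\mathrm c}$. (ii) $\inf_{\zeta\in\mathbb T}a_\Psi(\zeta)>0$. (iii) $\det D\Psi(\zeta)>0$ for every $\zeta\in\mathbb T$.
   Context: $\mathbb D=\{z\in\mathbb C:|z|<1\}$, $\mathbb T=\partial\mathbb D$. Differentials $D\Psi$ are real, with $\mathbb C$ identified with $\mathbb R^2$. The notation $A(z)\asymp B(z)$ means that there are constants $0<c\le C<\infty$, independent of $z$ (possibly depending on the map), with $cB\le A\le CB$. Sequences are indexed families $\Lambda=(\lambda_j)$ (finite or countably infinite) of points of $\mathbb D$; the image $\Phi(\Lambda)=(\Phi(\lambda_j))$ retains repeated terms. $\mathcal C$ denotes the class of Carleson (interpolating) sequences: $\Lambda=(\lambda_j)\in\mathcal C$ if every bounded scalar sequence $(a_j)$ is of the form $a_j=f(\lambda_j)$ for some $f\in H^\infty(\mathbb D)$. Finite sequences of distinct points belong to $\mathcal C$; a sequence with a repeated term does not. $\mathcal C_{\leftrightarrow}^{\mathrm c}$ is the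 class of continuous maps $\Phi:\mathbb D\to\mathbb D$ such that for every indexed sequence $\Lambda\subset\mathbb D$, $\Lambda\in\mathcal C\Leftrightarrow\Phi(\Lambda)\in\mathcal C$. $\mathcal P_{\mathrm c}=\{\Phi\in\mathcal C_{\leftrightarrow}^{\mathrm c}:1-|\Phi(z)|^2\asymp1-|z|^2\text{ for }z\in\mathbb D\}$. Every $\Phi\in\mathcal P_{\mathrm c}$ is a homeomorphism of $\mathbb D$ extending uniquely to a homeomorphism of $\overline{\mathbb D}$; $h_\Phi$ is the restriction of the extension to $\mathbb T$. $\mathcal K_{\mathrm c}=\{\Phi\in\mathcal P_{\mathrm c}:h_\Phi=\operatorname{id}_{\mathbb T}\}$. *)

theory Defs
  imports "HOL-Analysis.Analysis"
begin

abbreviation unit_disc :: "complex set" ("\<D>")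
  where "\<D> \<equiv> ball 0 1"

abbreviation unit_circle :: "complex set" ("\<T>")
  where "\<T> \<equiv> sphere 0 1"

definition H_infinity :: "(complex \<Rightarrow> complex) set" where
  "H_infinity = {f. f holomorphic_on \<D> \<and> bounded (f ` \<D>)}"

text \<open>
  A finite or countably infinite family \<open>(\<lambda>\<^sub>j)\<close> is encoded by an index set \<open>J :: nat set\<close> (possibly
  finite) and a function of which only the values on \<open>J\<close> matter. Repeated terms are allowed.
\<close>

definition carleson_seq :: "nat set \<Rightarrow> (nat \<Rightarrow> complex) \<Rightarrow> bool" where
  "carleson_seq J lam \<longleftrightarrow>
     lam \<in> J \<rightarrow> \<D> \<and>
     (\<forall>a :: nat \<Rightarrow> complex. bounded (a ` J) \<longrightarrow> (\<exists>f\<in>H_infinity. \<forall>j\<in>J. f (lam j) = a j))"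

text \<open>
  Maps on \<open>\<D>\<close> are total functions on the complex numbers; membership in the following classes
  depends only on their values on \<open>\<D>\<close>.
\<close>

definition carleson_equiv_maps :: "(complex \<Rightarrow> complex) set" where
  "carleson_equiv_maps =
     {\<Phi>. \<Phi> \<in> \<D> \<rightarrow> \<D> \<and> continuous_on \<D> \<Phi> \<and>
         (\<forall>J lam. lam \<in> J \<rightarrow> \<D> \<longrightarrow>
            (carleson_seq J lam \<longleftrightarrow> carleson_seq J (\<lambda>j. \<Phi> (lam j))))}"

definition P_c :: "(complex \<Rightarrow> complex) set" where
  "P_c =
     {\<Phi> \<in> carleson_equiv_maps.
        \<exists>c C. 0 < c \<and> c \<le> C \<and>
          (\<forall>z\<in>\<D>. c * (1 - (cmod z)\<^sup>2) \<le> 1 - (cmod (\<Phi> z))\<^sup>2 \<and>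
                 1 - (cmod (\<Phi> z))\<^sup>2 \<le> C * (1 - (cmod z)\<^sup>2))}"

text \<open>
  The homeomorphic extension to the closed disc; requiring it to be \<open>undefined\<close> outside the closed
  disc makes it unique as a total function. By density of \<open>\<D>\<close> there is at most one, and every
  element of \<open>P_c\<close> has one.
\<close>

definition disc_extension :: "(complex \<Rightarrow> complex) \<Rightarrow> complex \<Rightarrow> complex" where
  "disc_extension \<Phi> =
     (THE E. E \<in> extensional (cball 0 1) \<and> (\<exists>G. homeomorphism (cball 0 1) (cball 0 1) E G) \<and> (\<forall>z\<in>\<D>. E z = \<Phi> z))"

definition boundary_map :: "(complex \<Rightarrow> complex) \<Rightarrow> complex \<Rightarrow> complex" where
  "boundary_map \<Phi> = restrict (disc_extension \<Phi>) \<T>"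

definition K_c :: "(complex \<Rightarrow> complex) set" where
  "K_c = {\<Phi> \<in> P_c. \<forall>\<zeta>\<in>\<T>. boundary_map \<Phi> \<zeta> = \<zeta>}"

text \<open>
  Real differentiability class \<open>C\<^sup>1\<close>: the derivative is only real-linear.
\<close>

definition C1_closed_disc :: "(complex \<Rightarrow> complex) \<Rightarrow> bool" where
  "C1_closed_disc \<Psi> \<longleftrightarrow>
     (\<exists>U F. \<exists>F' :: complex \<Rightarrow> complex \<Rightarrow>\<^sub>L complex.
        open U \<and> cball 0 1 \<subseteq> U \<and> (\<forall>z\<in>cball 0 1. F z = \<Psi> z) \<and>
        (\<forall>z\<in>U. (F has_derivative blinfun_apply (F' z)) (at z)) \<and> continuous_on U F')"

text \<open>
  The derivative of \<open>\<Psi>\<close> at a point of the closed disc is taken relative to the closed disc, so that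
  it only depends on \<open>\<Psi>\<close> there. Since the closed disc is convex with nonempty interior, this
  derivative is unique, and it is the derivative of every \<open>C\<^sup>1\<close> extension, see lemma \<open>D_disc_eq\<close>.
\<close>

definition D_disc :: "(complex \<Rightarrow> complex) \<Rightarrow> complex \<Rightarrow> complex \<Rightarrow> complex" where
  "D_disc \<Psi> z = frechet_derivative \<Psi> (at z within cball 0 1)"

text \<open>Matrix of a real-linear map in the real basis \<open>1, \<i>\<close>.\<close>

definition real_matrix :: "(complex \<Rightarrow> complex) \<Rightarrow> real^2^2" where
  "real_matrix L = vector [vector [Re (L 1), Re (L \<i>)], vector [Im (L 1), Im (L \<i>)]]"

definition radial_coeff :: "(complex \<Rightarrow> complex) \<Rightarrow> complex \<Rightarrow> real" where
  "radial_coeff \<Psi> \<zeta> = Re (cnj \<zeta> * D_disc \<Psi> \<zeta> \<zeta>)"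

lemma D_disc_eq:
  assumes F: "(F has_derivative L) (at z)" and eq: "\<And>w. w \<in> cball 0 1 \<Longrightarrow> F w = \<Psi> w"
    and z: "z \<in> cball 0 1"
  shows "D_disc \<Psi> z = L"
proof -
  have 1: "(\<Psi> has_derivative L) (at z within cball 0 1)"
    using has_derivative_transform[OF z _ has_derivative_at_withinI[OF F]] eq by simp
  then have 2: "(\<Psi> has_derivative D_disc \<Psi> z) (at z within cball 0 1)"
    unfolding D_disc_def by (metis frechet_derivative_works differentiable_def)
  let ?M = "\<lambda>v. D_disc \<Psi> z v - L v"
  have d: "((\<lambda>_. 0) has_derivative ?M) (at z within cball 0 1)"
    using has_derivative_diff[OF 2 1] by simp
  have lin: "linear ?M" using d by (rule has_derivative_linear)
  have key: "?M (w - z) = 0" if w: "w \<in> cball 0 1" for w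
  proof -
    let ?g = "\<lambda>t::real. z + t *\<^sub>R (w - z)"
    have sub: "?g ` {0..1} \<subseteq> cball 0 1"
    proof
      fix y assume "y \<in> ?g ` {0..1}"
      then obtain t where t: "0 \<le> t" "t \<le> 1" and y: "y = ?g t" by auto
      have "y = (1 - t) *\<^sub>R z + t *\<^sub>R w" unfolding y by (simp add: algebra_simps)
      then show "y \<in> cball 0 1"
        using convexD_alt[OF convex_cball z w t] by simp
    qed
    have g: "(?g has_derivative (\<lambda>t. t *\<^sub>R (w - z))) (at 0 within {0..1})"
      by (auto intro!: derivative_eq_intros)
    have "((\<lambda>_. 0) has_derivative ?M) (at (?g 0) within ?g ` {0..1})"
      using has_derivative_subset[OF d sub] by simp
    from diff_chain_within[OF g this]
    have "((\<lambda>_. 0) has_derivative (\<lambda>t. ?M (t *\<^sub>R (w - z)))) (at 0 within {0..1::real})"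
      by (simp add: o_def)
    then have "((\<lambda>_. 0) has_vector_derivative ?M (w - z)) (at 0 within {0..1::real})"
      unfolding has_vector_derivative_def
      using linear_scale[OF lin] by simp
    moreover have "((\<lambda>_. 0::complex) has_vector_derivative 0) (at 0 within {0..1::real})"
      by simp
    ultimately show ?thesis
      by (intro vector_derivative_unique_within_closed_interval[of 0 "1::real" 0 "\<lambda>_. 0"])
        (simp_all add: cbox_interval)
  qed
  have "?M v = 0" for v
  proof -
    have z0: "?M z = 0"
      using key[of 0] linear_diff[OF lin, of 0 z] linear_0[OF lin] by simp
    have unit: "?M u = 0" if "u \<in> cball 0 1" for u
      using key[OF that] linear_diff[OF lin, of u z] z0 by simp
    show ?thesis
    proof (cases "v = 0")
      case True then show ?thesis using linear_0[OF lin] by simp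
    next
      case False
      then have "?M (v /\<^sub>R norm v) = 0" by (intro unit) (simp add: dist_norm)
      then show ?thesis using linear_scale[OF lin, of "inverse (norm v)" v] False by simp
    qed
  qed
  then show ?thesis by (simp add: fun_eq_iff)
qed

end

theory Submission
  imports Defs "HOL-Complex_Analysis.Complex_Analysis"
begin

text \<open>
  Near the unit circle \<open>\<Psi>\<close> is governed by its derivative there. Since \<open>\<Psi>\<close> fixes the circle, the
  derivative at \<open>\<zeta>\<close> fixes the tangent vector \<open>\<i> * \<zeta>\<close>; in the basis \<open>\<zeta>, \<i> * \<zeta>\<close> it is therefore
  triangular with diagonal \<open>a, 1\<close>, where \<open>a\<close> is the radial coefficient. So its determinant is
  \<open>a\<close>, and continuity of \<open>a\<close> on the compact circle makes pointwise positivity the same as a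
  positive infimum. If \<open>1 - \<bar>\<Psi> z\<bar>\<^sup>2\<close> dominates a multiple of \<open>1 - \<bar>z\<bar>\<^sup>2\<close>, comparing both along a
  radius gives a positive lower bound for \<open>a\<close>.

  The substance is that positivity of \<open>a\<close> makes \<open>\<Psi>\<close> preserve interpolating sequences in both
  directions. By Carleson's theorem (\<open>carleson_seq_iff_uniformly_separated\<close>) interpolation is a
  condition on the numbers \<open>1 - \<rho>\<^sup>2\<close>, with \<open>\<rho>\<close> the pseudohyperbolic distance: they stay away
  from 1 for distinct terms, and their sums with one term fixed are uniformly bounded. The map
  \<open>\<Psi>\<close> distorts
    \<open>1 - \<rho>(z, w)\<^sup>2 = (1 - \<bar>z\<bar>\<^sup>2) (1 - \<bar>w\<bar>\<^sup>2) / \<bar>1 - cnj z * w\<bar>\<^sup>2\<close>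
  by bounded factors only: positivity of \<open>a\<close> controls \<open>1 - \<bar>z\<bar>\<^sup>2\<close>, and the denominator is
  controlled because \<open>\<bar>1 - cnj z * w\<bar>\<close> is comparable to \<open>(1 - \<bar>z\<bar>\<^sup>2) + \<bar>z - w\<bar>\<close>,
  while \<open>\<Psi>\<close> is Lipschitz and displaces each point by at most a multiple of its
  distance to the circle. Separation passes to the image because \<open>\<Psi>\<close> is bi-Lipschitz at small
  scales near the circle, and elsewhere separated points are far apart in the Euclidean sense, so
  that injectivity and compactness suffice.

  Both halves of Carleson's theorem are reduced to finite sets of nodes. For necessity, a bounded
  function vanishing on a finite set is dominated by the corresponding Blaschke product, and a
  sparse subsequence of bad nodes turns a failure of the uniform bound into a single 0-1 sequence
  without bounded interpolant. For sufficiency, P. Jones' explicit formula interpolates on finite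
  sets with a uniform bound, and Montel's theorem passes to the limit.
\<close>

section \<open>Pseudohyperbolic distance and finite Blaschke products\<close>

text \<open>
  \<open>1 - \<rho>\<^sup>2\<close> for the pseudohyperbolic distance \<open>\<rho> z w = \<bar>z - w\<bar> / \<bar>1 - cnj z * w\<bar>\<close>. Unlike \<open>\<rho>\<close>
  it is a quotient of positive quantities, which makes it easy to compare under a map.
\<close>
definition codist :: "complex \<Rightarrow> complex \<Rightarrow> real" where
  "codist z w = (1 - (cmod z)\<^sup>2) * (1 - (cmod w)\<^sup>2) / (cmod (1 - cnj z * w))\<^sup>2"

lemma codist_commute: "codist z w = codist w z"
proof -
  have "cmod (1 - cnj z * w) = cmod (cnj (1 - cnj z * w))" by (rule complex_mod_cnj[symmetric])
  also have "\<dots> = cmod (1 - cnj w * z)" by (simp add: mult.commute)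
  finally show ?thesis by (simp add: codist_def mult.commute)
qed

lemma cmod_one_minus_cnj_mult:
  "(cmod (1 - cnj z * w))\<^sup>2 = (cmod (z - w))\<^sup>2 + (1 - (cmod z)\<^sup>2) * (1 - (cmod w)\<^sup>2)"
  unfolding cmod_power2 by (simp add: power2_eq_square algebra_simps)

lemma one_minus_cmod_sq_pos: "z \<in> \<D> \<Longrightarrow> 0 < 1 - (cmod z)\<^sup>2"
  by (simp add: abs_square_less_1)

text \<open>
  Together these bounds say that \<open>\<bar>1 - cnj z * w\<bar>\<close> is, up to constants, the sum of \<open>\<bar>z - w\<bar>\<close> and
  the distances of the two points to the circle.
\<close>
lemma cmod_one_minus_cnj_mult_bounds:
  assumes "z \<in> \<D>" "w \<in> \<D>"
  shows "0 < cmod (1 - cnj z * w)" "1 - cmod z \<le> cmod (1 - cnj z * w)"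
    "1 - cmod w \<le> cmod (1 - cnj z * w)" "cmod (z - w) \<le> cmod (1 - cnj z * w)"
    "cmod (1 - cnj z * w) \<le> (1 - (cmod z)\<^sup>2) + cmod (z - w)" "cmod (1 - cnj z * w) \<le> 2"
proof -
  have z: "cmod z < 1" and w: "cmod w < 1" using assms by auto
  have zw: "cmod (cnj z * w) = cmod z * cmod w" by (simp add: norm_mult)
  have b: "1 - cmod z * cmod w \<le> cmod (1 - cnj z * w)"
    using norm_triangle_ineq2[of 1 "cnj z * w"] zw by simp
  have "cmod z * cmod w \<le> cmod z * 1" "cmod z * cmod w \<le> 1 * cmod w"
    using z w by (intro mult_mono; simp)+
  with b show 1: "1 - cmod z \<le> cmod (1 - cnj z * w)" and "1 - cmod w \<le> cmod (1 - cnj z * w)"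
    by auto
  show "0 < cmod (1 - cnj z * w)" using 1 z by linarith
  show "cmod (z - w) \<le> cmod (1 - cnj z * w)"
  proof (rule power2_le_imp_le)
    have "0 \<le> (1 - (cmod z)\<^sup>2) * (1 - (cmod w)\<^sup>2)"
      using assms[THEN one_minus_cmod_sq_pos] by (intro mult_nonneg_nonneg) linarith+
    then show "(cmod (z - w))\<^sup>2 \<le> (cmod (1 - cnj z * w))\<^sup>2"
      unfolding cmod_one_minus_cnj_mult by linarith
  qed (rule norm_ge_zero)
  have "1 - cnj z * w = of_real (1 - (cmod z)\<^sup>2) + cnj z * (z - w)"
    unfolding of_real_diff complex_norm_square by (simp add: algebra_simps)
  then have "cmod (1 - cnj z * w) \<le> cmod (of_real (1 - (cmod z)\<^sup>2)) + cmod (cnj z * (z - w))"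
    using norm_triangle_ineq by metis
  also have "cmod (of_real (1 - (cmod z)\<^sup>2)) = 1 - (cmod z)\<^sup>2"
    using one_minus_cmod_sq_pos[OF assms(1)] by (simp only: norm_of_real)
  also have "cmod (cnj z * (z - w)) \<le> 1 * cmod (z - w)"
    unfolding norm_mult using z by (intro mult_mono) auto
  finally show "cmod (1 - cnj z * w) \<le> (1 - (cmod z)\<^sup>2) + cmod (z - w)" by simp
  have "cmod z * cmod w \<le> 1 * 1" using z w by (intro mult_mono) auto
  then show "cmod (1 - cnj z * w) \<le> 2"
    using norm_triangle_ineq4[of 1 "cnj z * w"] zw by simp
qed

lemma codist_pos: "z \<in> \<D> \<Longrightarrow> w \<in> \<D> \<Longrightarrow> 0 < codist z w"
  using one_minus_cmod_sq_pos cmod_one_minus_cnj_mult_bounds(1)[of z w] by (simp add: codist_def)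

lemma codist_self: "z \<in> \<D> \<Longrightarrow> codist z z = 1"
  using cmod_one_minus_cnj_mult[of z z] one_minus_cmod_sq_pos[of z]
  by (simp add: codist_def power2_eq_square)

lemma one_minus_codist:
  assumes "z \<in> \<D>" "w \<in> \<D>"
  shows "1 - codist z w = (cmod (z - w) / cmod (1 - cnj z * w))\<^sup>2"
    and "1 - codist z w = (cmod (Moebius_function 0 z w))\<^sup>2"
proof -
  have "cmod (1 - cnj z * w) \<noteq> 0" using cmod_one_minus_cnj_mult_bounds(1)[OF assms] by simp
  then show 1: "1 - codist z w = (cmod (z - w) / cmod (1 - cnj z * w))\<^sup>2"
    using cmod_one_minus_cnj_mult[of z w] by (simp add: codist_def field_simps)
  then show "1 - codist z w = (cmod (Moebius_function 0 z w))\<^sup>2"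
    by (simp add: Moebius_function_simple norm_divide norm_minus_commute)
qed

lemma codist_le_1: "z \<in> \<D> \<Longrightarrow> w \<in> \<D> \<Longrightarrow> codist z w \<le> 1"
  using one_minus_codist(1)[of z w] zero_le_power2[of "cmod (z - w) / cmod (1 - cnj z * w)"] by linarith

lemma Moebius_function_nonzero:
  assumes "z \<in> \<D>" "w \<in> \<D>" "z \<noteq> w" shows "Moebius_function 0 z w \<noteq> 0"
  using assms cmod_one_minus_cnj_mult_bounds(1)[of z w] by (simp add: Moebius_function_simple)

text \<open>
  Division by a Blaschke factor does not increase the sup norm. A disc automorphism moves the zero to
  the origin, where this is the Schwarz lemma.
\<close>
lemma divide_by_Moebius_function:
  assumes holf: "f holomorphic_on \<D>" and le: "\<And>z. z \<in> \<D> \<Longrightarrow> cmod (f z) \<le> M"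
    and w: "w \<in> \<D>" and fw: "f w = 0"
  obtains g where "g holomorphic_on \<D>" "\<And>z. z \<in> \<D> \<Longrightarrow> cmod (g z) \<le> M"
    "\<And>z. z \<in> \<D> \<Longrightarrow> f z = Moebius_function 0 w z * g z"
proof -
  define F where "F = f \<circ> Moebius_function 0 (- w)"
  have w1: "cmod w < 1" using w by simp
  have inD: "Moebius_function 0 a z \<in> \<D>" if "cmod a < 1" "z \<in> \<D>" for a z
    using Moebius_function_norm_lt_1 that by simp
  have holF: "F holomorphic_on \<D>"
    unfolding F_def using w1 inD
    by (intro holomorphic_on_compose_gen[OF _ holf] Moebius_function_holomorphic) auto
  have F0: "F 0 = 0" by (simp add: F_def Moebius_function_of_zero fw)
  have M0: "0 \<le> M" using le[OF w] fw by simp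
  have Fle: "cmod (F z) \<le> M" if "z \<in> \<D>" for z
    unfolding F_def using le inD[of "-w" z] w1 that by simp
  have lin: "cmod (F z) \<le> M * cmod z" if z: "z \<in> \<D>" for z
  proof -
    \<comment> \<open>The Schwarz lemma needs a strict bound, hence the larger \<open>N\<close>, which is then decreased to \<open>M\<close>.\<close>
    have "cmod (F z) \<le> N * cmod z" if N: "M < N" for N
    proof -
      have N0: "0 < N" using M0 N by simp
      have "cmod ((\<lambda>z. F z / of_real N) z) \<le> cmod z"
      proof (rule Schwarz_Lemma(1))
        show "(\<lambda>z. F z / of_real N) holomorphic_on \<D>"
          using N0 by (intro holomorphic_intros holF) auto
        show "cmod (F u / of_real N) < 1" if "cmod u < 1" for u
          using Fle[of u] that N0 N by (simp add: norm_divide)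
      qed (use F0 z in auto)
      then show ?thesis using N0 by (simp add: norm_divide field_simps)
    qed
    then have "\<And>N. N > M \<Longrightarrow> cmod (F z) \<le> N * cmod z" .
    then have "((\<lambda>N. N * cmod z) \<longlongrightarrow> M * cmod z) (at_right M)"
      and "\<forall>\<^sub>F N in at_right M. cmod (F z) \<le> N * cmod z"
      by (auto intro!: tendsto_intros simp: eventually_at_right_less eventually_at_filter)
    then show ?thesis by (rule tendsto_lowerbound) simp
  qed
  obtain h where holh: "h holomorphic_on \<D>" and h: "\<And>z. cmod z < 1 \<Longrightarrow> F z = z * h z"
    using Schwarz3[OF holF F0] by metis
  have hle: "cmod (h z) \<le> M" if z: "z \<in> \<D>" for z
  proof (cases "z = 0")
    case False
    then show ?thesis using lin[OF z] h[of z] z by (simp add: norm_mult mult.commute)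
  next
    case True
    have "(h \<longlongrightarrow> h 0) (at 0)"
      using holomorphic_on_imp_continuous_on[OF holh]
      by (metis centre_in_ball continuous_on_eq_continuous_at isCont_def open_ball zero_less_one)
    moreover have "\<forall>\<^sub>F u in at 0. cmod (h u) \<le> M"
      unfolding eventually_at
    proof (intro exI[of _ 1] conjI ballI impI)
      fix u :: complex assume u: "u \<noteq> 0 \<and> dist u 0 < 1"
      then show "cmod (h u) \<le> M" using lin[of u] h[of u] by (simp add: norm_mult mult.commute)
    qed simp
    ultimately show ?thesis using True Lim_norm_ubound[of "at (0::complex)" h] by simp
  qed
  show ?thesis
  proof
    show "(h \<circ> Moebius_function 0 w) holomorphic_on \<D>"
      using w1 inD by (intro holomorphic_on_compose_gen[OF _ holh] Moebius_function_holomorphic) auto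
    show "cmod ((h \<circ> Moebius_function 0 w) z) \<le> M" if "z \<in> \<D>" for z
      using hle inD w1 that by simp
    show "f z = Moebius_function 0 w z * (h \<circ> Moebius_function 0 w) z" if z: "z \<in> \<D>" for z
    proof -
      have "f z = F (Moebius_function 0 w z)"
        unfolding F_def using Moebius_function_compose[of "-w" w z] w1 z by simp
      also have "\<dots> = Moebius_function 0 w z * h (Moebius_function 0 w z)"
        using h inD[OF w1 z] by simp
      finally show ?thesis by simp
    qed
  qed
qed

text \<open>
  Splitting off the zeros one at a time: the function is dominated by \<open>M\<close> times the Blaschke product
  of its zeros. A repeated term would still be only a simple zero, hence the injectivity of \<open>lam\<close>.
\<close>
lemma cmod_le_prod_Moebius_function:
  assumes "finite F" and "inj_on lam F" and "lam \<in> F \<rightarrow> \<D>"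
    and "f holomorphic_on \<D>" and "\<And>z. z \<in> \<D> \<Longrightarrow> cmod (f z) \<le> M"
    and "\<And>j. j \<in> F \<Longrightarrow> f (lam j) = 0" and "z \<in> \<D>"
  shows "cmod (f z) \<le> M * (\<Prod>j\<in>F. cmod (Moebius_function 0 (lam j) z))"
  using assms
proof (induction F arbitrary: f rule: finite_induct)
  case empty
  then show ?case by simp
next
  case (insert x F)
  obtain g where g: "g holomorphic_on \<D>" "\<And>z. z \<in> \<D> \<Longrightarrow> cmod (g z) \<le> M"
    "\<And>z. z \<in> \<D> \<Longrightarrow> f z = Moebius_function 0 (lam x) z * g z"
    using divide_by_Moebius_function[of f M "lam x"] insert.prems by auto
  have "g (lam j) = 0" if j: "j \<in> F" for j
  proof -
    have "lam x \<noteq> lam j" using insert.prems(1) insert.hyps j by auto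
    moreover have xD: "lam x \<in> \<D>" and jD: "lam j \<in> \<D>"
      using insert.prems(2) j by (blast intro: PiE)+
    ultimately have "Moebius_function 0 (lam x) (lam j) \<noteq> 0"
      by (intro Moebius_function_nonzero)
    moreover have "Moebius_function 0 (lam x) (lam j) * g (lam j) = 0"
      using g(3)[OF jD] insert.prems(5)[of j] j by simp
    ultimately show ?thesis by simp
  qed
  then have "cmod (g z) \<le> M * (\<Prod>j\<in>F. cmod (Moebius_function 0 (lam j) z))"
    using insert.prems g by (intro insert.IH) auto
  then have "cmod (f z) \<le> cmod (Moebius_function 0 (lam x) z) *
      (M * (\<Prod>j\<in>F. cmod (Moebius_function 0 (lam j) z)))"
    using g(3)[OF \<open>z \<in> \<D>\<close>] by (simp add: norm_mult mult_left_mono)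
  then show ?case using insert.hyps by (simp add: mult_ac)
qed

section \<open>Necessity in Carleson's theorem\<close>

text \<open>
  This is Carleson's condition that the products \<open>\<Prod>\<^sub>j \<rho>(\<lambda>\<^sub>j, \<lambda>\<^sub>k)\<close> over \<open>j \<noteq> k\<close> are bounded below
  uniformly in \<open>k\<close>, with the product traded for a separation and a sum. In this form it is
  visibly stable under maps that change \<^const>\<open>codist\<close> by bounded factors and keep separated
  points separated. Distinctness of the terms is implied, because \<open>codist z z = 1\<close>.
\<close>
definition uniformly_separated :: "nat set \<Rightarrow> (nat \<Rightarrow> complex) \<Rightarrow> bool" where
  "uniformly_separated J lam \<longleftrightarrow>
     (\<exists>\<epsilon>>0. \<forall>j\<in>J. \<forall>k\<in>J. j \<noteq> k \<longrightarrow> codist (lam j) (lam k) \<le> 1 - \<epsilon>) \<and>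
     (\<exists>C. \<forall>k\<in>J. \<forall>F. finite F \<longrightarrow> F \<subseteq> J \<longrightarrow> (\<Sum>j\<in>F. codist (lam j) (lam k)) \<le> C)"

lemma prod_one_minus_le_exp:
  fixes x :: "'a \<Rightarrow> real"
  assumes "\<And>j. j \<in> F \<Longrightarrow> x j \<le> 1"
  shows "(\<Prod>j\<in>F. 1 - x j) \<le> exp (- (\<Sum>j\<in>F. x j))"
proof (cases "finite F")
  case True
  have "(\<Prod>j\<in>F. 1 - x j) \<le> (\<Prod>j\<in>F. exp (- x j))"
    using assms exp_ge_add_one_self[of "- x _"] by (intro prod_mono) (simp add: add.commute)
  then show ?thesis using True by (simp add: exp_sum sum_negf flip: sum_negf)
qed simp

text \<open>
  The elementary bound is \<open>1 / (1 - x) = 1 + x / (1 - x) \<le> exp (x / \<epsilon>)\<close>. Together with the upper bound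
  by \<open>exp (- \<Sum> x)\<close> it makes bounded sums and products bounded below equivalent under separation.
\<close>
lemma prod_one_minus_ge_exp:
  fixes x :: "'a \<Rightarrow> real"
  assumes "0 < \<epsilon>" and "\<And>j. j \<in> F \<Longrightarrow> 0 \<le> x j" and "\<And>j. j \<in> F \<Longrightarrow> x j \<le> 1 - \<epsilon>"
  shows "exp (- (\<Sum>j\<in>F. x j) / \<epsilon>) \<le> (\<Prod>j\<in>F. 1 - x j)"
proof (cases "finite F")
  case True
  have "exp (- (x j / \<epsilon>)) \<le> 1 - x j" if j: "j \<in> F" for j
  proof -
    have e: "\<epsilon> \<le> 1 - x j" and x0: "0 \<le> x j" using assms j by force+
    have p: "0 < 1 - x j" using e assms(1) by linarith
    have "inverse (1 - x j) = 1 + x j / (1 - x j)" using p by (simp add: field_simps)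
    also have "\<dots> \<le> 1 + x j / \<epsilon>" using e x0 assms(1) by (simp add: frac_le)
    also have "\<dots> \<le> exp (x j / \<epsilon>)" by (rule exp_ge_add_one_self)
    finally show ?thesis using p by (simp add: exp_minus le_imp_inverse_le[of "inverse (1 - x j)", simplified])
  qed
  then have "(\<Prod>j\<in>F. exp (- (x j / \<epsilon>))) \<le> (\<Prod>j\<in>F. 1 - x j)" by (intro prod_mono) auto
  moreover have "(\<Prod>j\<in>F. exp (- (x j / \<epsilon>))) = exp (- (\<Sum>j\<in>F. x j) / \<epsilon>)"
    using True by (simp add: exp_sum[symmetric] sum_negf sum_divide_distrib)
  ultimately show ?thesis by simp
qed simp

text \<open>
  If one point is much closer to the circle than the other, their pseudohyperbolic distance is
  nearly 1.
\<close>
lemma codist_le_ratio: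
  assumes "z \<in> \<D>" "w \<in> \<D>"
  shows "codist z w \<le> 4 * ((1 - cmod w) / (1 - cmod z))"
proof -
  have z: "cmod z < 1" and w: "cmod w < 1" using assms by auto
  have b: "1 - (cmod u)\<^sup>2 \<le> 2 * (1 - cmod u)" for u
    using zero_le_power2[of "1 - cmod u"] by (simp add: power2_eq_square algebra_simps)
  have "codist z w \<le> (2 * (1 - cmod z)) * (2 * (1 - cmod w)) / (1 - cmod z)\<^sup>2"
    unfolding codist_def
    using b[of z] b[of w] cmod_one_minus_cnj_mult_bounds(2)[OF assms] z w
      one_minus_cmod_sq_pos[OF assms(1)] one_minus_cmod_sq_pos[OF assms(2)]
    by (intro frac_le mult_mono power_mono mult_nonneg_nonneg) auto
  also have "\<dots> = 4 * ((1 - cmod w) / (1 - cmod z))"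
  proof -
    have "(2 * a) * (2 * b) / a\<^sup>2 = 4 * (b / a)" if "a \<noteq> 0" for a b :: real
      using that by (simp add: power2_eq_square)
    from this[of "1 - cmod z"] show ?thesis using z by (metis diff_gt_0_iff_gt less_irrefl)
  qed
  finally show ?thesis .
qed

text \<open>
  The Blaschke bound for the zeros \<open>lam j\<close>, evaluated at \<open>lam k\<close> and squared so that \<^const>\<open>codist\<close>
  appears without roots.
\<close>
lemma interpolation_forces_product:
  assumes f: "f holomorphic_on \<D>" "\<And>z. z \<in> \<D> \<Longrightarrow> cmod (f z) \<le> M" and lam: "lam \<in> J \<rightarrow> \<D>"
    and inj: "inj_on lam J" and F: "finite F" "F \<subseteq> J" "\<And>j. j \<in> F \<Longrightarrow> f (lam j) = 0"
    and k: "k \<in> J" "f (lam k) = 1"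
  shows "1 \<le> M\<^sup>2 * (\<Prod>j\<in>F. 1 - codist (lam j) (lam k))"
proof -
  have FD: "lam j \<in> \<D>" if "j \<in> F" for j using lam F that by blast
  have kD: "lam k \<in> \<D>" using lam k by blast
  have "cmod (f (lam k)) \<le> M * (\<Prod>j\<in>F. cmod (Moebius_function 0 (lam j) (lam k)))"
    using f F FD kD inj_on_subset[OF inj F(2)] by (intro cmod_le_prod_Moebius_function) auto
  then have "1\<^sup>2 \<le> (M * (\<Prod>j\<in>F. cmod (Moebius_function 0 (lam j) (lam k))))\<^sup>2"
    using k by (intro power_mono) auto
  also have "\<dots> = M\<^sup>2 * (\<Prod>j\<in>F. (cmod (Moebius_function 0 (lam j) (lam k)))\<^sup>2)"
    by (simp add: power_mult_distrib prod_power_distrib)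
  also have "(\<Prod>j\<in>F. (cmod (Moebius_function 0 (lam j) (lam k)))\<^sup>2)
      = (\<Prod>j\<in>F. 1 - codist (lam j) (lam k))"
    using FD kD by (intro prod.cong) (auto simp: one_minus_codist(2)[symmetric] simp del: mem_ball)
  finally show ?thesis by simp
qed

lemma carleson_seq_obtain_indicator:
  assumes car: "carleson_seq J lam"
  obtains f M where "f holomorphic_on \<D>" "\<And>z. z \<in> \<D> \<Longrightarrow> cmod (f z) \<le> M"
    "\<And>j. j \<in> J \<Longrightarrow> f (lam j) = (if j \<in> S then 1 else 0)"
proof -
  have b: "bounded ((\<lambda>i. if i \<in> S then 1 else 0 :: complex) ` J)"
    by (rule finite_imp_bounded, rule finite_subset[of _ "{0,1}"]) auto
  from car have "\<forall>a. bounded (a ` J) \<longrightarrow> (\<exists>f\<in>H_infinity. \<forall>j\<in>J. f (lam j) = a j)"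
    unfolding carleson_seq_def by (rule conjunct2)
  from this[rule_format, OF b] obtain f
    where f: "f \<in> H_infinity" "\<forall>i\<in>J. f (lam i) = (if i \<in> S then 1 else 0 :: complex)" by blast
  obtain M where "\<forall>z\<in>\<D>. cmod (f z) \<le> M"
    using f(1) unfolding H_infinity_def bounded_iff by blast
  then show ?thesis using that[of f M] f by (simp add: H_infinity_def)
qed

lemma carleson_seq_imp_inj_on:
  assumes car: "carleson_seq J lam" shows "inj_on lam J"
proof (rule inj_onI, rule ccontr)
  fix j k assume jk: "j \<in> J" "k \<in> J" "lam j = lam k" "j \<noteq> k"
  obtain f M where "f holomorphic_on \<D>" "\<And>z. z \<in> \<D> \<Longrightarrow> cmod (f z) \<le> M"
    and f: "\<And>i. i \<in> J \<Longrightarrow> f (lam i) = (if i \<in> {j} then 1 else 0)"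
    using carleson_seq_obtain_indicator[OF car, of "{j}"] by metis
  show False using f[OF jk(1)] f[OF jk(2)] jk(3,4) by simp
qed

lemma carleson_seq_product_pos:
  assumes car: "carleson_seq J lam" and k: "k \<in> J"
  shows "\<exists>d>0. \<forall>F. finite F \<longrightarrow> F \<subseteq> J - {k} \<longrightarrow> d \<le> (\<Prod>j\<in>F. 1 - codist (lam j) (lam k))"
proof -
  have lam: "lam \<in> J \<rightarrow> \<D>" using car by (simp add: carleson_seq_def)
  obtain f M where f: "f holomorphic_on \<D>" "\<And>z. z \<in> \<D> \<Longrightarrow> cmod (f z) \<le> M"
    "\<And>j. j \<in> J \<Longrightarrow> f (lam j) = (if j \<in> {k} then 1 else 0)"
    using carleson_seq_obtain_indicator[OF car, of "{k}"] by metis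
  have *: "1 \<le> M\<^sup>2 * (\<Prod>j\<in>F. 1 - codist (lam j) (lam k))" if "finite F" "F \<subseteq> J - {k}" for F
  proof (rule interpolation_forces_product[OF f(1,2) lam carleson_seq_imp_inj_on[OF car]])
    show "f (lam j) = 0" if "j \<in> F" for j 
    proof -
      have "j \<in> J" "j \<noteq> k" using that \<open>F \<subseteq> J - {k}\<close> by auto
      then show ?thesis using f(3)[of j] by simp
    qed
  qed (use that f(3)[OF k] k in auto)
  have "1 \<le> M\<^sup>2" using *[of "{}"] by simp
  then have M: "0 < M\<^sup>2" by linarith
  show ?thesis
    using * M by (intro exI[of _ "1 / M\<^sup>2"]) (simp add: divide_le_eq mult.commute)
qed

text \<open>
  Products bounded below at one node already yield the Blaschke condition: the sum of the \<^const>\<open>codist\<close>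
  to that node is finite, and each node in a smaller disc contributes at least a fixed amount. Hence
  the nodes can accumulate only at the circle.
\<close>
lemma finite_if_product_pos:
  assumes lam: "lam \<in> J \<rightarrow> \<D>" and k: "k \<in> J" and d: "0 < d"
    and prod: "\<And>F. finite F \<Longrightarrow> F \<subseteq> J - {k} \<Longrightarrow> d \<le> (\<Prod>j\<in>F. 1 - codist (lam j) (lam k))"
    and r: "r < 1"
  shows "finite {j\<in>J. cmod (lam j) \<le> r}"
proof (cases "0 \<le> r")
  case False
  then have "{j\<in>J. cmod (lam j) \<le> r} = {}" using norm_ge_zero order_trans by blast
  then show ?thesis by (simp only: finite.emptyI)
next
  case True
  have D: "lam j \<in> \<D>" if "j \<in> J" for j using lam that by blast
  define c where "c = (1 - r\<^sup>2) * (1 - (cmod (lam k))\<^sup>2) / 4"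
  have c: "0 < c" unfolding c_def using True r one_minus_cmod_sq_pos[OF D[OF k]]
    by (simp add: abs_square_less_1)
  have cle: "c \<le> codist (lam j) (lam k)" if j: "j \<in> J" "cmod (lam j) \<le> r" for j
  proof -
    have "cmod (1 - cnj (lam j) * lam k) \<le> 2" and p: "0 < cmod (1 - cnj (lam j) * lam k)"
      using cmod_one_minus_cnj_mult_bounds[OF D[OF j(1)] D[OF k]] by auto
    then have "(cmod (1 - cnj (lam j) * lam k))\<^sup>2 \<le> 2\<^sup>2" by (intro power_mono) auto
    moreover have "(cmod (lam j))\<^sup>2 \<le> r\<^sup>2" using j by (intro power_mono) auto
    ultimately show ?thesis
      unfolding c_def codist_def using p one_minus_cmod_sq_pos[OF D[OF k]] one_minus_cmod_sq_pos[OF D[OF j(1)]]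
      by (intro frac_le mult_mono mult_nonneg_nonneg) auto
  qed
  have "finite ({j\<in>J. cmod (lam j) \<le> r} - {k})"
  proof (rule conjunct1, rule finite_if_finite_subsets_card_bdd)
    fix F assume F: "F \<subseteq> {j\<in>J. cmod (lam j) \<le> r} - {k}" "finite F"
    have "d \<le> (\<Prod>j\<in>F. 1 - codist (lam j) (lam k))" using F by (intro prod) auto
    also have "\<dots> \<le> exp (- (\<Sum>j\<in>F. codist (lam j) (lam k)))"
      using F D k codist_le_1 by (intro prod_one_minus_le_exp) auto
    finally have "ln d \<le> - (\<Sum>j\<in>F. codist (lam j) (lam k))"
      using d by (metis ln_exp ln_le_cancel_iff exp_gt_zero)
    moreover have "(\<Sum>j\<in>F. c) \<le> (\<Sum>j\<in>F. codist (lam j) (lam k))"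
      using F cle by (intro sum_mono) auto
    ultimately have "of_nat (card F) * c \<le> - ln d" by simp
    then have "real (card F) \<le> - ln d / c" using c by (simp only: pos_le_divide_eq)
    then show "card F \<le> nat \<lceil>- ln d / c\<rceil>" by linarith
  qed
  then show ?thesis by simp
qed

text \<open>
  When the distances to the circle decrease at this rate, \<open>codist (t m) (t n) \<le> 4 / 16 ^ max m n\<close>. This is at most
  \<open>1/4\<close> off the diagonal and has row sums at most \<open>4 * (\<Sum>m. (1/4) ^ m) = 16/3\<close>, which gives the exponent
  \<open>(16/3) / (3/4) = 64/9\<close>.
\<close>
lemma sparse_sequence_product:
  fixes t :: "nat \<Rightarrow> complex"
  assumes D: "\<And>n. t n \<in> \<D>"
    and dec: "\<And>n. 1 - cmod (t (Suc n)) \<le> (1 - cmod (t n)) / 16 ^ Suc n"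
    and A: "finite A" "n \<notin> A"
  shows "exp (- (64 / 9)) \<le> (\<Prod>m\<in>A. 1 - codist (t m) (t n))"
proof -
  have t: "0 < 1 - cmod (t n)" for n using D[of n] by simp
  have mono: "1 - cmod (t (n + i)) \<le> 1 - cmod (t n)" for n i
  proof (induction i)
    case (Suc i)
    have "(1::real) \<le> 16 ^ Suc (n + i)" by (rule one_le_power) simp
    then have "(1 - cmod (t (n + i))) / 16 ^ Suc (n + i) \<le> (1 - cmod (t (n + i))) / 1"
      using t[of "n + i"] by (intro divide_left_mono) auto
    then show ?case using dec[of "n + i"] Suc by simp
  qed simp
  have lt: "codist (t m) (t n) \<le> 4 / 16 ^ n" if mn: "m < n" for m n
  proof -
    obtain i where i: "n = Suc (m + i)" using mn less_imp_Suc_add by blast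
    have "1 - cmod (t n) \<le> (1 - cmod (t (m + i))) / 16 ^ n" using dec[of "m + i"] i by simp
    also have "\<dots> \<le> (1 - cmod (t m)) / 16 ^ n" using mono by (intro divide_right_mono) auto
    finally have "(1 - cmod (t n)) / (1 - cmod (t m)) \<le> 1 / 16 ^ n"
      using t[of m] by (simp add: field_simps)
    then have "4 * ((1 - cmod (t n)) / (1 - cmod (t m))) \<le> 4 * (1 / 16 ^ n)"
      by (rule mult_left_mono) simp
    with codist_le_ratio[OF D D, of m n] have "codist (t m) (t n) \<le> 4 * (1 / 16 ^ n)"
      by (rule order_trans)
    then show ?thesis by simp
  qed
  have le: "codist (t m) (t n) \<le> 4 / 16 ^ max m n" if "m \<noteq> n" for m n
    using that lt[of m n] lt[of n m] codist_commute[of "t m" "t n"]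
    by (cases "m < n") (auto simp: max_def not_less)
  have 0: "exp (- (\<Sum>m\<in>A. codist (t m) (t n)) / (3/4)) \<le> (\<Prod>m\<in>A. 1 - codist (t m) (t n))"
  proof (rule prod_one_minus_ge_exp)
    show "codist (t m) (t n) \<le> 1 - 3/4" if "m \<in> A" for m
    proof -
      have mn: "m \<noteq> n" using that A by auto
      then have "(16::real) ^ 1 \<le> 16 ^ max m n" by (intro power_increasing) auto
      then have "4 / 16 ^ max m n \<le> 4 / (16::real) ^ 1" by (intro divide_left_mono) auto
      also have "\<dots> = 1 - 3 / 4" by simp
      finally show ?thesis using le[OF mn] by linarith
    qed
    show "0 \<le> codist (t m) (t n)" for m using codist_pos[OF D D] less_imp_le by blast
  qed simp
  have 1: "(\<Sum>m\<in>A. codist (t m) (t n)) \<le> (\<Sum>m\<in>A. 4 * (1/4) ^ m)"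
  proof (rule sum_mono)
    fix m assume "m \<in> A"
    then have mn: "m \<noteq> n" using A by auto
    have "(4::real) ^ m \<le> 16 ^ max m n"
      by (rule order_trans[OF power_mono[of 4 "16::real" m] power_increasing]) auto
    then have "4 / 16 ^ max m n \<le> 4 / (4::real) ^ m" by (intro divide_left_mono) auto
    then show "codist (t m) (t n) \<le> 4 * (1/4) ^ m" using le[OF mn] by (simp add: power_divide)
  qed
  have 2: "(\<Sum>m\<in>A. 4 * (1/4) ^ m) \<le> (16/3 :: real)"
  proof -
    have "(\<lambda>m. 4 * (1/4) ^ m) sums (4 * (1 / (1 - 1/4 :: real)))"
      by (intro sums_mult geometric_sums) auto
    then have s: "(\<lambda>m. 4 * (1/4) ^ m) sums (16/3 :: real)" by simp
    show ?thesis
      using sum_le_suminf[OF sums_summable[OF s] A(1)] sums_unique[OF s] by simp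
  qed
  have "- (64 / 9) \<le> - (\<Sum>m\<in>A. codist (t m) (t n)) / (3/4)"
    using order_trans[OF 1 2] by simp
  then have "exp (- (64 / 9)) \<le> exp (- (\<Sum>m\<in>A. codist (t m) (t n)) / (3/4))"
    by (simp only: exp_le_cancel_iff)
  then show ?thesis using 0 by (rule order_trans)
qed

text \<open>
  A gliding hump that replaces the open mapping theorem. If the products are not bounded below
  uniformly, there are nodes \<open>k 0, k 1, \<dots>\<close> with products tending to 0, and they can be chosen as
  sparse as desired, since only finitely many nodes lie in a smaller disc and each single product is
  positive. The sparse nodes among themselves contribute only a bounded factor, so the smallness comes from
  the remaining nodes. A bounded function equal to 1 on the sparse nodes and 0 on the others
  contradicts the Blaschke bound.
\<close>
lemma carleson_seq_product_lower_bound: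
  assumes car: "carleson_seq J lam"
  shows "\<exists>d>0. \<forall>k\<in>J. \<forall>F. finite F \<longrightarrow> F \<subseteq> J - {k} \<longrightarrow> d \<le> (\<Prod>j\<in>F. 1 - codist (lam j) (lam k))"
proof (rule ccontr)
  assume neg: "\<not> ?thesis"
  have lam: "lam \<in> J \<rightarrow> \<D>" using car by (simp add: carleson_seq_def)
  have D: "lam j \<in> \<D>" if "j \<in> J" for j using lam that by blast
  have inj: "inj_on lam J" by (rule carleson_seq_imp_inj_on[OF car])
  define bad where "bad e k \<longleftrightarrow> k \<in> J \<and> (\<exists>F. finite F \<and> F \<subseteq> J - {k} \<and>
      (\<Prod>j\<in>F. 1 - codist (lam j) (lam k)) < e)" for e k
  obtain \<delta> where \<delta>: "\<And>k. k \<in> J \<Longrightarrow> 0 < \<delta> k"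
    "\<And>k F. k \<in> J \<Longrightarrow> finite F \<Longrightarrow> F \<subseteq> J - {k} \<Longrightarrow> \<delta> k \<le> (\<Prod>j\<in>F. 1 - codist (lam j) (lam k))"
    using carleson_seq_product_pos[OF car] by metis
  have bad_exists: "\<exists>k. bad e k \<and> r < cmod (lam k)" if e: "0 < e" and r: "r < 1" for e r
  proof (rule ccontr)
    assume no: "\<not> ?thesis"
    obtain k0 where k0: "k0 \<in> J" using neg zero_less_one by blast
    have fin: "finite {j\<in>J. cmod (lam j) \<le> r}"
      using finite_if_product_pos[OF lam k0 \<delta>(1)[OF k0] \<delta>(2)[OF k0] r] .
    define d where "d = Min (insert e (\<delta> ` {j\<in>J. cmod (lam j) \<le> r}))"
    have "0 < d" unfolding d_def using fin e \<delta>(1) by (subst Min_gr_iff) auto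
    then obtain k F where kF: "k \<in> J" "finite F" "F \<subseteq> J - {k}"
      "(\<Prod>j\<in>F. 1 - codist (lam j) (lam k)) < d"
      using neg by (meson not_le)
    have "d \<le> e" unfolding d_def using fin by (intro Min_le) auto
    then have "bad e k"
      using kF(1-3) less_le_trans[OF kF(4)] unfolding bad_def by blast
    then have "cmod (lam k) \<le> r" using no by force
    then have "d \<le> \<delta> k" unfolding d_def using fin kF(1) by (intro Min_le) auto
    then show False using \<delta>(2)[OF kF(1-3)] kF(4) by linarith
  qed
  have "\<exists>k. \<forall>n. bad (1 / real (Suc n)) (k n) \<and>
      1 - cmod (lam (k (Suc n))) \<le> (1 - cmod (lam (k n))) / 16 ^ Suc n"
  proof (rule dependent_nat_choice)
    show "\<exists>x. bad (1 / real (Suc 0)) x" using bad_exists[of 1 0] by auto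
    fix x n assume "bad (1 / real (Suc n)) x"
    then have "0 < 1 - cmod (lam x)" using D unfolding bad_def by fastforce
    then have "0 < (1 - cmod (lam x)) / 16 ^ Suc n" by simp
    then obtain y where "bad (1 / real (Suc (Suc n))) y" "1 - (1 - cmod (lam x)) / 16 ^ Suc n < cmod (lam y)"
      using bad_exists[of "1 / real (Suc (Suc n))" "1 - (1 - cmod (lam x)) / 16 ^ Suc n"] by auto
    then show "\<exists>y. bad (1 / real (Suc (Suc n))) y \<and> 1 - cmod (lam y) \<le> (1 - cmod (lam x)) / 16 ^ Suc n"
      by (intro exI[of _ y]) auto
  qed
  then obtain k where k: "\<And>n. bad (1 / real (Suc n)) (k n)"
    and dec: "\<And>n. 1 - cmod (lam (k (Suc n))) \<le> (1 - cmod (lam (k n))) / 16 ^ Suc n" by blast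
  have kJ: "k n \<in> J" for n using k by (simp add: bad_def)
  have "cmod (lam (k n)) < cmod (lam (k (Suc n)))" for n
  proof -
    have "0 < 1 - cmod (lam (k n))" using D[OF kJ] by simp
    moreover have "1 < (16::real) ^ Suc n" by (rule one_less_power) auto
    ultimately have "(1 - cmod (lam (k n))) / 16 ^ Suc n < (1 - cmod (lam (k n))) / 1"
      by (intro divide_strict_left_mono) auto
    then show ?thesis using dec[of n] by simp
  qed
  then have "strict_mono (\<lambda>n. cmod (lam (k n)))" by (rule strict_monoI_Suc)
  then have kinj: "inj k" by (metis (mono_tags, lifting) injI strict_mono_eq)
  obtain f M where f: "f holomorphic_on \<D>" "\<And>z. z \<in> \<D> \<Longrightarrow> cmod (f z) \<le> M"
    "\<And>j. j \<in> J \<Longrightarrow> f (lam j) = (if j \<in> range k then 1 else 0)"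
    using carleson_seq_obtain_indicator[OF car, of "range k"] by metis
  have "exp (- (64 / 9)) * real (Suc n) \<le> M\<^sup>2" for n
  proof -
    let ?q = "\<lambda>F. \<Prod>j\<in>F. 1 - codist (lam j) (lam (k n))"
    obtain F where F: "finite F" "F \<subseteq> J - {k n}" "?q F < 1 / real (Suc n)"
      using k[of n] unfolding bad_def by blast
    \<comment> \<open>The function vanishes only on the part of \<open>F\<close> outside the sparse nodes, so the product over \<open>F\<close> is
      split accordingly.\<close>
    have 1: "1 \<le> M\<^sup>2 * ?q (F - range k)"
      using F f(3) kJ by (intro interpolation_forces_product[OF f(1,2) lam inj]) auto
    have im: "F \<inter> range k = k ` (k -` F)" by auto
    have "?q (F \<inter> range k) = (\<Prod>m\<in>k -` F. 1 - codist (lam (k m)) (lam (k n)))"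
      unfolding im by (subst prod.reindex) (auto intro: inj_on_subset[OF kinj])
    moreover have "exp (- (64 / 9)) \<le> (\<Prod>m\<in>k -` F. 1 - codist (lam (k m)) (lam (k n)))"
      using D kJ dec F by (intro sparse_sequence_product[of "\<lambda>n. lam (k n)"])
        (auto intro: finite_vimageI kinj)
    ultimately have 2: "exp (- (64 / 9)) \<le> ?q (F \<inter> range k)" by simp
    have 3: "?q F = ?q (F \<inter> range k) * ?q (F - range k)"
      using prod.Int_Diff[OF F(1), of _ "range k"] .
    have 4: "0 \<le> ?q (F - range k)"
      using F(2) D codist_le_1[OF D D[OF kJ[of n]]] by (intro prod_nonneg) auto
    have "exp (- (64 / 9)) \<le> exp (- (64 / 9)) * (M\<^sup>2 * ?q (F - range k))"
      using 1 by simp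
    also have "\<dots> = M\<^sup>2 * (exp (- (64 / 9)) * ?q (F - range k))" by simp
    also have "\<dots> \<le> M\<^sup>2 * (?q (F \<inter> range k) * ?q (F - range k))"
      using 2 4 by (intro mult_left_mono mult_right_mono) auto
    also have "\<dots> \<le> M\<^sup>2 * (1 / real (Suc n))"
      using F(3) 3 by (intro mult_left_mono) auto
    finally show ?thesis by (simp add: field_simps)
  qed
  then have le: "real (Suc n) \<le> M\<^sup>2 / exp (- (64 / 9))" for n
    by (simp only: pos_le_divide_eq exp_gt_zero mult.commute)
  obtain n where "M\<^sup>2 / exp (- (64 / 9)) < real n" using reals_Archimedean2 by blast
  then have "real (Suc n) < real n" by (rule le_less_trans[OF le])
  then show False by simp
qed

lemma carleson_seq_imp_uniformly_separated:
  assumes car: "carleson_seq J lam"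
  shows "uniformly_separated J lam"
proof -
  have lam: "lam \<in> J \<rightarrow> \<D>" using car by (simp add: carleson_seq_def)
  have D: "lam j \<in> \<D>" if "j \<in> J" for j using lam that by blast
  obtain d where d: "0 < d" and all: "\<forall>k\<in>J. \<forall>F. finite F \<longrightarrow> F \<subseteq> J - {k} \<longrightarrow>
      d \<le> (\<Prod>j\<in>F. 1 - codist (lam j) (lam k))"
    using carleson_seq_product_lower_bound[OF car] by blast
  have prod: "d \<le> (\<Prod>j\<in>F. 1 - codist (lam j) (lam k))"
    if "k \<in> J" "finite F" "F \<subseteq> J - {k}" for k F
    using all that by simp
  have sep: "codist (lam j) (lam k) \<le> 1 - d" if "j \<in> J" "k \<in> J" "j \<noteq> k" for j k
    using prod[of k "{j}"] that by auto
  have sum: "(\<Sum>j\<in>F. codist (lam j) (lam k)) \<le> 1 - ln d" if k: "k \<in> J" and F: "finite F" "F \<subseteq> J" for k F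
  proof -
    have "d \<le> (\<Prod>j\<in>F - {k}. 1 - codist (lam j) (lam k))" using k F by (intro prod) auto
    also have "\<dots> \<le> exp (- (\<Sum>j\<in>F - {k}. codist (lam j) (lam k)))"
      using F D k codist_le_1 by (intro prod_one_minus_le_exp) auto
    finally have "ln d \<le> - (\<Sum>j\<in>F - {k}. codist (lam j) (lam k))"
      using d by (metis ln_exp ln_le_cancel_iff exp_gt_zero)
    moreover have "(\<Sum>j\<in>F. codist (lam j) (lam k))
        \<le> codist (lam k) (lam k) + (\<Sum>j\<in>F - {k}. codist (lam j) (lam k))"
      using F codist_pos[OF D[OF k] D[OF k]] by (cases "k \<in> F") (auto simp: sum.remove[of F k])
    ultimately show ?thesis using codist_self[OF D[OF k]] by simp
  qed
  show ?thesis
    unfolding uniformly_separated_def using sep sum d by blast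
qed

section \<open>Sufficiency in Carleson's theorem\<close>

text \<open>
  A lower Riemann sum for the integral of \<open>exp (- t)\<close> over \<open>{0..\<Sum> b}\<close>: sorted by decreasing \<open>r\<close>, each
  tail sum is the right end of an interval of length \<open>b j\<close>. Ties in \<open>r\<close> only enlarge the tails.
\<close>
lemma sum_exp_tails_le:
  fixes b :: "'a \<Rightarrow> real" and r :: "'a \<Rightarrow> real"
  assumes "finite F" "\<And>j. j \<in> F \<Longrightarrow> 0 \<le> b j"
  shows "(\<Sum>j\<in>F. b j * exp (- (\<Sum>m\<in>{m\<in>F. r j \<le> r m}. b m))) \<le> 1 - exp (- (\<Sum>j\<in>F. b j))"
  using assms
proof (induction F rule: finite_ranking_induct[where f = "\<lambda>j. - r j"])
  case empty
  then show ?case by simp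
next
  case (insert x S)
  show ?case
  proof (cases "x \<in> S")
    case True
    then show ?thesis using insert by (simp add: insert_absorb)
  next
    case False
    let ?s = "\<Sum>j\<in>S. b j"
    have eq: "{m \<in> insert x S. r x \<le> r m} = insert x S" using insert.hyps(2) by auto
    have "(\<Sum>j\<in>S. b j * exp (- (\<Sum>m\<in>{m\<in>insert x S. r j \<le> r m}. b m)))
        \<le> (\<Sum>j\<in>S. b j * exp (- (\<Sum>m\<in>{m\<in>S. r j \<le> r m}. b m)))"
      using insert.hyps(1) insert.prems
      by (intro sum_mono mult_left_mono) (auto intro!: sum_mono2)
    also have "\<dots> \<le> 1 - exp (- ?s)" using insert.IH insert.prems by auto
    finally have "(\<Sum>j\<in>insert x S. b j * exp (- (\<Sum>m\<in>{m\<in>insert x S. r j \<le> r m}. b m)))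
        \<le> b x * exp (- (b x + ?s)) + (1 - exp (- ?s))"
      using False insert.hyps(1) eq by simp
    also have "exp (- ?s) = exp (- (b x + ?s)) * exp (b x)" by (simp flip: exp_add)
    also have "b x * exp (- (b x + ?s)) + (1 - exp (- (b x + ?s)) * exp (b x))
        = 1 - exp (- (b x + ?s)) - exp (- (b x + ?s)) * (exp (b x) - (1 + b x))"
      by (simp add: algebra_simps)
    also have "\<dots> \<le> 1 - exp (- (b x + ?s))"
      using exp_ge_add_one_self[of "b x"] by (simp add: add.commute)
    finally show ?thesis using False insert.hyps(1) by simp
  qed
qed

lemma Re_Cayley: "Re ((1 + w) / (1 - w)) = (1 - (cmod w)\<^sup>2) / (cmod (1 - w))\<^sup>2"
  unfolding Re_divide cmod_power2 by (simp add: power2_eq_square algebra_simps)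

lemma Re_weighted_Cayley:
  "Re (of_real (1 - (cmod w)\<^sup>2) * ((1 + cnj w * z) / (1 - cnj w * z)))
      = (1 - (cmod w)\<^sup>2) * (1 - (cmod w)\<^sup>2 * (cmod z)\<^sup>2) / (cmod (1 - cnj w * z))\<^sup>2"
proof -
  have *: "Re (of_real a * x) = a * Re x" for a x by simp
  show ?thesis
    unfolding * Re_Cayley norm_mult complex_mod_cnj power_mult_distrib by simp
qed

text \<open>
  P. Jones' interpolation formula. The term at \<open>j\<close> is the normalised Blaschke product of the other
  nodes, times the kernel \<open>\<kappa> j\<close>, times an exponential factor that makes the sum of the kernels
  bounded. In the exponent, \<open>P m\<close> has positive real part at least \<open>\<bar>\<kappa> m\<bar>\<close> on the disc, so the
  sum over \<open>j\<close> falls under the preceding Riemann sum bound. At \<open>z = lam j\<close> the exponent must not be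
  large: this is why only nodes with \<open>cmod (lam j) \<le> cmod (lam m)\<close> enter it, as for these the real
  part of \<open>P m (lam j)\<close> is at most \<open>2 * codist (lam m) (lam j)\<close>.
\<close>
lemma bounded_finite_interpolation:
  assumes F: "finite F" and lam: "lam \<in> F \<rightarrow> \<D>" and \<epsilon>: "0 < \<epsilon>"
    and sep: "\<And>j k. j \<in> F \<Longrightarrow> k \<in> F \<Longrightarrow> j \<noteq> k \<Longrightarrow> codist (lam j) (lam k) \<le> 1 - \<epsilon>"
    and sum: "\<And>k. k \<in> F \<Longrightarrow> (\<Sum>j\<in>F. codist (lam j) (lam k)) \<le> C"
    and a: "\<And>j. j \<in> F \<Longrightarrow> cmod (a j) \<le> A" and A: "0 \<le> A"
  shows "\<exists>f. f holomorphic_on \<D> \<and> (\<forall>z\<in>\<D>. cmod (f z) \<le> A * exp (C / \<epsilon> + 2 * C)) \<and> (\<forall>j\<in>F. f (lam j) = a j)"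
proof -
  have D: "lam j \<in> \<D>" if "j \<in> F" for j using lam that by blast
  define \<beta> where "\<beta> j z = (\<Prod>m\<in>F - {j}. Moebius_function 0 (lam m) z)" for j z
  define \<kappa> where "\<kappa> j z = (of_real (1 - (cmod (lam j))\<^sup>2) / (1 - cnj (lam j) * z))\<^sup>2" for j z
  define P where "P m z = of_real (1 - (cmod (lam m))\<^sup>2) * ((1 + cnj (lam m) * z) / (1 - cnj (lam m) * z))" for m z
  \<comment> \<open>The nodes at least as close to the circle as \<open>lam j\<close>, including \<open>j\<close> itself.\<close>
  define T where "T j = {m\<in>F. cmod (lam j) \<le> cmod (lam m)}" for j
  define f where "f z = (\<Sum>j\<in>F. a j * (\<beta> j z / \<beta> j (lam j)) * \<kappa> j z *
      exp ((\<Sum>m\<in>T j. P m (lam j)) - (\<Sum>m\<in>T j. P m z)))" for z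
  define b where "b z m = (1 - (cmod (lam m))\<^sup>2)\<^sup>2 / (cmod (1 - cnj (lam m) * z))\<^sup>2" for m z
  have nz: "1 - cnj (lam m) * z \<noteq> 0" if "m \<in> F" "z \<in> \<D>" for m z
    using cmod_one_minus_cnj_mult_bounds(1)[OF D[OF that(1)] that(2)] by auto
  have TF: "m \<in> F" if "m \<in> T j" for m j using that by (simp add: T_def)
  have \<beta>_low: "exp (- C / \<epsilon>) \<le> cmod (\<beta> j (lam j))" if j: "j \<in> F" for j
  proof -
    have "(\<Sum>m\<in>F - {j}. codist (lam m) (lam j)) \<le> (\<Sum>m\<in>F. codist (lam m) (lam j))"
      using F codist_pos[OF D D[OF j]] by (intro sum_mono2) (auto intro: less_imp_le)
    also have "\<dots> \<le> C" by (rule sum[OF j])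
    finally have "exp (- C / \<epsilon>) \<le> exp (- (\<Sum>m\<in>F - {j}. codist (lam m) (lam j)) / \<epsilon>)"
      using \<epsilon> by (simp add: divide_right_mono)
    also have "\<dots> \<le> (\<Prod>m\<in>F - {j}. 1 - codist (lam m) (lam j))"
      using \<epsilon> j sep codist_pos[OF D D[OF j]]
      by (intro prod_one_minus_ge_exp) (auto intro: less_imp_le)
    also have "\<dots> \<le> (\<Prod>m\<in>F - {j}. cmod (Moebius_function 0 (lam m) (lam j)))"
    proof (rule prod_mono, intro conjI)
      fix m assume m: "m \<in> F - {j}"
      then have mF: "m \<in> F" by simp
      show "0 \<le> 1 - codist (lam m) (lam j)" using codist_le_1[OF D[OF mF] D[OF j]] by simp
      have "cmod (Moebius_function 0 (lam m) (lam j)) \<le> 1"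
        using Moebius_function_norm_lt_1[of "lam m" "lam j" 0] D[OF mF] D[OF j] by simp
      then show "1 - codist (lam m) (lam j) \<le> cmod (Moebius_function 0 (lam m) (lam j))"
        unfolding one_minus_codist(2)[OF D[OF mF] D[OF j]]
        by (simp add: power2_eq_square mult_left_le)
    qed
    finally show ?thesis by (simp add: \<beta>_def prod_norm)
  qed
  have \<beta>_nz: "\<beta> j (lam j) \<noteq> 0" if j: "j \<in> F" for j
    using \<beta>_low[OF j] exp_gt_zero[of "- C / \<epsilon>"] by (metis norm_zero not_le)
  have \<beta>_up: "cmod (\<beta> j z) \<le> 1" if z: "z \<in> \<D>" for j z
    unfolding \<beta>_def prod_norm[symmetric]
    using z D Moebius_function_norm_lt_1[of _ z 0] by (intro prod_le_1) (auto intro: less_imp_le)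
  have \<kappa>: "cmod (\<kappa> j z) = b z j" for j z
    unfolding \<kappa>_def b_def norm_power norm_divide norm_of_real power_divide power2_abs ..
  have hol: "f holomorphic_on \<D>"
    unfolding f_def \<beta>_def \<kappa>_def P_def
    using Moebius_function_holomorphic D nz \<beta>_nz[unfolded \<beta>_def] TF
    by (intro holomorphic_intros) auto
  have interp: "f (lam k) = a k" if k: "k \<in> F" for k
  proof -
    have "\<beta> j (lam k) = 0" if "j \<in> F - {k}" for j
      unfolding \<beta>_def using that F k
      by (intro prod_zero bexI[of _ k]) (auto simp: Moebius_function_eq_zero)
    then have "f (lam k) = a k * (\<beta> k (lam k) / \<beta> k (lam k)) * \<kappa> k (lam k)"
      unfolding f_def by (subst sum.remove[OF F k]) simp
    moreover have "\<kappa> k (lam k) = 1"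
    proof -
      have "of_real (1 - (cmod (lam k))\<^sup>2) = 1 - cnj (lam k) * lam k"
        unfolding of_real_diff complex_norm_square by (simp add: mult.commute)
      then show ?thesis using nz[OF k D[OF k]] by (simp add: \<kappa>_def)
    qed
    ultimately show ?thesis using \<beta>_nz[OF k] by simp
  qed
  have bound: "cmod (f z) \<le> A * exp (C / \<epsilon> + 2 * C)" if z: "z \<in> \<D>" for z
  proof -
    have z1: "(cmod z)\<^sup>2 \<le> 1" using one_minus_cmod_sq_pos[OF z] by simp
    have b0: "0 \<le> b z m" for m by (simp add: b_def)
    have Pz: "b z m \<le> Re (P m z)" if m: "m \<in> F" for m
    proof -
      have p: "0 < 1 - (cmod (lam m))\<^sup>2" using one_minus_cmod_sq_pos[OF D[OF m]] .
      have "(cmod (lam m))\<^sup>2 * (cmod z)\<^sup>2 \<le> (cmod (lam m))\<^sup>2 * 1"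
        using z1 by (intro mult_left_mono) auto
      then have "(1 - (cmod (lam m))\<^sup>2)\<^sup>2 \<le> (1 - (cmod (lam m))\<^sup>2) * (1 - (cmod (lam m))\<^sup>2 * (cmod z)\<^sup>2)"
        unfolding power2_eq_square[of "1 - _"] using p by (intro mult_left_mono) auto
      then show ?thesis unfolding P_def b_def Re_weighted_Cayley
        by (rule divide_right_mono) simp
    qed
    have Plam: "Re (P m (lam j)) \<le> 2 * codist (lam m) (lam j)" if j: "j \<in> F" and m: "m \<in> T j" for j m
    proof -
      have mF: "m \<in> F" and le: "cmod (lam j) \<le> cmod (lam m)" using m by (auto simp: T_def)
      have p: "0 < 1 - (cmod (lam m))\<^sup>2" using one_minus_cmod_sq_pos[OF D[OF mF]] .
      have j1: "(cmod (lam j))\<^sup>2 \<le> 1" using one_minus_cmod_sq_pos[OF D[OF j]] by simp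
      have le2: "(cmod (lam j))\<^sup>2 \<le> (cmod (lam m))\<^sup>2" using le by (intro power_mono) auto
      have "(cmod (lam j))\<^sup>2 * (1 - (cmod (lam m))\<^sup>2) \<le> 1 * (1 - (cmod (lam j))\<^sup>2)"
        by (intro mult_mono) (use j1 le2 p in linarith)+
      then have "1 - (cmod (lam m))\<^sup>2 * (cmod (lam j))\<^sup>2 \<le> 2 * (1 - (cmod (lam j))\<^sup>2)"
        by (simp add: algebra_simps)
      then have "(1 - (cmod (lam m))\<^sup>2) * (1 - (cmod (lam m))\<^sup>2 * (cmod (lam j))\<^sup>2)
          \<le> (1 - (cmod (lam m))\<^sup>2) * (2 * (1 - (cmod (lam j))\<^sup>2))"
        using p by (intro mult_left_mono) auto
      then have "Re (P m (lam j)) \<le> (1 - (cmod (lam m))\<^sup>2) * (2 * (1 - (cmod (lam j))\<^sup>2))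
          / (cmod (1 - cnj (lam m) * lam j))\<^sup>2"
        unfolding P_def Re_weighted_Cayley by (rule divide_right_mono) simp
      then show ?thesis by (simp only: codist_def times_divide_eq_right mult_ac)
    qed
    have summand: "cmod (a j * (\<beta> j z / \<beta> j (lam j)) * \<kappa> j z *
        exp ((\<Sum>m\<in>T j. P m (lam j)) - (\<Sum>m\<in>T j. P m z)))
        \<le> A * exp (C / \<epsilon> + 2 * C) * (b z j * exp (- (\<Sum>m\<in>T j. b z m)))" if j: "j \<in> F" for j
    proof -
      have 1: "cmod (\<beta> j z / \<beta> j (lam j)) \<le> exp (C / \<epsilon>)"
      proof -
        have "cmod (\<beta> j z / \<beta> j (lam j)) \<le> 1 / exp (- C / \<epsilon>)"
          unfolding norm_divide using \<beta>_up[OF z] \<beta>_low[OF j] by (intro frac_le) auto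
        then show ?thesis by (simp add: exp_minus field_simps)
      qed
      have "(\<Sum>m\<in>T j. Re (P m (lam j))) \<le> (\<Sum>m\<in>T j. 2 * codist (lam m) (lam j))"
        using Plam[OF j] by (intro sum_mono)
      also have "\<dots> \<le> (\<Sum>m\<in>F. 2 * codist (lam m) (lam j))"
        using F codist_pos[OF D D[OF j]] by (intro sum_mono2) (auto simp: T_def intro: less_imp_le)
      also have "\<dots> \<le> 2 * C" using sum[OF j] by (simp flip: sum_distrib_left)
      finally have 2: "(\<Sum>m\<in>T j. Re (P m (lam j))) \<le> 2 * C" .
      have "(\<Sum>m\<in>T j. b z m) \<le> (\<Sum>m\<in>T j. Re (P m z))"
        by (intro sum_mono Pz) (rule TF)
      with 2 have 3: "cmod (exp ((\<Sum>m\<in>T j. P m (lam j)) - (\<Sum>m\<in>T j. P m z)))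
          \<le> exp (2 * C) * exp (- (\<Sum>m\<in>T j. b z m))"
        by (simp add: norm_exp_eq_Re Re_sum flip: exp_add)
      have "cmod (a j * (\<beta> j z / \<beta> j (lam j)) * \<kappa> j z *
          exp ((\<Sum>m\<in>T j. P m (lam j)) - (\<Sum>m\<in>T j. P m z)))
          \<le> A * exp (C / \<epsilon>) * b z j * (exp (2 * C) * exp (- (\<Sum>m\<in>T j. b z m)))"
        unfolding norm_mult \<kappa>
        using a[OF j] 1 3 A b0 by (intro mult_mono mult_nonneg_nonneg) auto
      then show ?thesis by (simp add: exp_add mult_ac)
    qed
    have "cmod (f z) \<le> (\<Sum>j\<in>F. A * exp (C / \<epsilon> + 2 * C) * (b z j * exp (- (\<Sum>m\<in>T j. b z m))))"
      unfolding f_def by (rule sum_norm_le) (rule summand)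
    also have "\<dots> = A * exp (C / \<epsilon> + 2 * C) * (\<Sum>j\<in>F. b z j * exp (- (\<Sum>m\<in>T j. b z m)))"
      by (simp only: sum_distrib_left)
    also have "\<dots> \<le> A * exp (C / \<epsilon> + 2 * C) * 1"
    proof (rule mult_left_mono)
      have "(\<Sum>j\<in>F. b z j * exp (- (\<Sum>m\<in>T j. b z m))) \<le> 1 - exp (- (\<Sum>j\<in>F. b z j))"
        unfolding T_def using F b0 by (intro sum_exp_tails_le)
      then show "(\<Sum>j\<in>F. b z j * exp (- (\<Sum>m\<in>T j. b z m))) \<le> 1"
        using exp_gt_zero[of "- (\<Sum>j\<in>F. b z j)"] by linarith
    qed (use A in simp)
    finally show ?thesis by simp
  qed
  show ?thesis using hol bound interp by blast
qed

text \<open>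
  The interpolants on \<open>J \<inter> {..n}\<close> form a normal family because their bound does not depend on \<open>n\<close>; a
  locally uniform limit interpolates on all of \<open>J\<close>.
\<close>
lemma uniformly_separated_imp_carleson_seq:
  assumes lam: "lam \<in> J \<rightarrow> \<D>" and us: "uniformly_separated J lam"
  shows "carleson_seq J lam"
  unfolding carleson_seq_def
proof (intro conjI allI impI)
  fix a :: "nat \<Rightarrow> complex" assume "bounded (a ` J)"
  then obtain A where "\<And>j. j \<in> J \<Longrightarrow> cmod (a j) \<le> A" unfolding bounded_iff by auto
  then have A: "\<And>j. j \<in> J \<Longrightarrow> cmod (a j) \<le> max 0 A" by fastforce
  obtain \<epsilon> C where \<epsilon>: "0 < \<epsilon>"
    and sep: "\<And>j k. j \<in> J \<Longrightarrow> k \<in> J \<Longrightarrow> j \<noteq> k \<Longrightarrow> codist (lam j) (lam k) \<le> 1 - \<epsilon>"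
    and sum: "\<forall>k\<in>J. \<forall>F. finite F \<longrightarrow> F \<subseteq> J \<longrightarrow> (\<Sum>j\<in>F. codist (lam j) (lam k)) \<le> C"
    using us unfolding uniformly_separated_def by metis
  define K where "K = max 0 A * exp (C / \<epsilon> + 2 * C)"
  have "\<exists>f. f holomorphic_on \<D> \<and> (\<forall>z\<in>\<D>. cmod (f z) \<le> K) \<and> (\<forall>j\<in>J \<inter> {..n}. f (lam j) = a j)" for n
    unfolding K_def using lam \<epsilon> sep sum A
    by (intro bounded_finite_interpolation) auto
  then obtain f where f: "\<And>n. f n holomorphic_on \<D>" "\<And>n z. z \<in> \<D> \<Longrightarrow> cmod (f n z) \<le> K"
    "\<And>n j. j \<in> J \<Longrightarrow> j \<le> n \<Longrightarrow> f n (lam j) = a j"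
    by (metis IntI atMost_iff)
  obtain g r where g: "g holomorphic_on \<D>" and r: "strict_mono (r :: nat \<Rightarrow> nat)"
    and lim: "\<And>x. x \<in> \<D> \<Longrightarrow> (\<lambda>n. f (r n) x) \<longlonglongrightarrow> g x"
  proof (rule Montel[of \<D> "range f" f])
    show "h holomorphic_on \<D>" if "h \<in> range f" for h using that f(1) by auto
    show "\<exists>B. \<forall>h\<in>range f. \<forall>z\<in>L. cmod (h z) \<le> B" if "compact L" "L \<subseteq> \<D>" for L
      using that f(2) by (intro exI[of _ K]) auto
  qed auto
  have "\<forall>z\<in>\<D>. cmod (g z) \<le> K"
  proof
    fix z assume z: "z \<in> \<D>"
    show "cmod (g z) \<le> K"
      using Lim_norm_ubound[OF _ lim[OF z]] f(2)[OF z] by simp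
  qed
  then have "g \<in> H_infinity" using g unfolding H_infinity_def bounded_iff by blast
  moreover have "g (lam j) = a j" if j: "j \<in> J" for j
  proof -
    have "\<forall>\<^sub>F n in sequentially. f (r n) (lam j) = a j"
      using eventually_ge_at_top[of j]
    proof eventually_elim
      case (elim n)
      then show ?case using f(3)[OF j] seq_suble[OF r, of n] by simp
    qed
    then have "(\<lambda>n. f (r n) (lam j)) \<longlonglongrightarrow> a j" by (rule tendsto_eventually)
    moreover have "(\<lambda>n. f (r n) (lam j)) \<longlonglongrightarrow> g (lam j)" using lam j by (intro lim) blast
    ultimately show ?thesis using LIMSEQ_unique by blast
  qed
  ultimately show "\<exists>f\<in>H_infinity. \<forall>j\<in>J. f (lam j) = a j" by blast
qed (use lam in blast)

theorem carleson_seq_iff_uniformly_separated: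
  "carleson_seq J lam \<longleftrightarrow> lam \<in> J \<rightarrow> \<D> \<and> uniformly_separated J lam"
  using carleson_seq_imp_uniformly_separated uniformly_separated_imp_carleson_seq
  by (auto simp: carleson_seq_def)

section \<open>Maps of class \<open>C\<^sup>1\<close> fixing the circle\<close>

lemma nearest_circle_point:
  fixes z :: complex
  assumes "z \<in> cball 0 1"
  obtains \<zeta> where "\<zeta> \<in> \<T>" "z - \<zeta> = - ((1 - cmod z) *\<^sub>R \<zeta>)" "cmod (z - \<zeta>) = 1 - cmod z"
proof -
  obtain \<zeta> :: complex where \<zeta>: "cmod \<zeta> = 1" "z = cmod z *\<^sub>R \<zeta>"
  proof (cases "z = 0")
    case True then show ?thesis using that[of 1] by simp
  next
    case False then show ?thesis using that[of "sgn z"] by (simp add: norm_sgn sgn_div_norm)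
  qed
  have 1: "z - \<zeta> = - ((1 - cmod z) *\<^sub>R \<zeta>)"
    using \<zeta>(2) by (simp add: scaleR_left_diff_distrib)
  have "cmod (z - \<zeta>) = 1 - cmod z" unfolding 1 using \<zeta>(1) assms by simp
  with 1 \<zeta>(1) show ?thesis by (intro that) auto
qed

text \<open>
  \<open>F\<close> is the \<open>C\<^sup>1\<close> extension and \<open>D\<close> its derivative, taken without restriction to the disc, so that
  at circle points it is the derivative relative to the closed disc by \<open>D_disc_eq\<close>.
\<close>
locale C1_disc_homeo =
  fixes \<Psi> F :: "complex \<Rightarrow> complex" and D :: "complex \<Rightarrow> complex \<Rightarrow>\<^sub>L complex"
  assumes homeo: "\<exists>G. homeomorphism (cball 0 1) (cball 0 1) \<Psi> G"
    and extension: "\<And>z. z \<in> cball 0 1 \<Longrightarrow> F z = \<Psi> z"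
    and deriv_extension: "\<And>z. z \<in> cball 0 1 \<Longrightarrow> (F has_derivative blinfun_apply (D z)) (at z)"
    and cont_D: "continuous_on (cball 0 1) D"
    and boundary: "\<And>\<zeta>. \<zeta> \<in> \<T> \<Longrightarrow> \<Psi> \<zeta> = \<zeta>"
begin

lemma deriv:
  assumes "z \<in> cball 0 1" shows "(\<Psi> has_derivative D z) (at z within cball 0 1)"
  using has_derivative_transform[OF assms _ has_derivative_at_withinI[OF deriv_extension[OF assms]]]
    extension by simp

lemma D_disc: "z \<in> cball 0 1 \<Longrightarrow> D_disc \<Psi> z = D z"
  using D_disc_eq[OF deriv_extension] extension by blast

lemma cont: "continuous_on (cball 0 1) \<Psi>"
  using homeo homeomorphism_cont1 by blast

text \<open>
  A point of the open disc cannot be sent to the circle, as the circle point already has itself as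
  preimage.
\<close>
lemma maps_disc: assumes "z \<in> \<D>" shows "\<Psi> z \<in> \<D>"
proof -
  obtain G where G: "homeomorphism (cball 0 1) (cball 0 1) \<Psi> G" using homeo by blast
  have z: "z \<in> cball 0 1" using assms by simp
  have c: "\<Psi> z \<in> cball 0 1" using homeomorphism_image1[OF G] z by blast
  have "\<Psi> z \<notin> \<T>"
  proof
    assume T: "\<Psi> z \<in> \<T>"
    then have "\<Psi> (\<Psi> z) = \<Psi> z" by (rule boundary)
    then have "\<Psi> z = z" using homeomorphism_apply1[OF G] z c by metis
    then show False using T assms by simp
  qed
  then show ?thesis using c by auto
qed

lemma dist_image_bounded_below:
  assumes "0 < \<eta>"
  shows "\<exists>\<mu>>0. \<forall>z\<in>cball 0 1. \<forall>w\<in>cball 0 1. \<eta> \<le> cmod (z - w) \<longrightarrow> \<mu> \<le> cmod (\<Psi> z - \<Psi> w)"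
proof -
  obtain G where G: "homeomorphism (cball 0 1) (cball 0 1) \<Psi> G" using homeo by blast
  have "uniformly_continuous_on (cball 0 1) G"
    using homeomorphism_cont2[OF G] compact_cball by (rule compact_uniformly_continuous)
  then obtain \<mu> where \<mu>: "0 < \<mu>" "\<And>x y. x \<in> cball 0 1 \<Longrightarrow> y \<in> cball 0 1 \<Longrightarrow> dist y x < \<mu> \<Longrightarrow> dist (G y) (G x) < \<eta>"
    using assms unfolding uniformly_continuous_on_def by metis
  have "\<mu> \<le> cmod (\<Psi> z - \<Psi> w)" if zw: "z \<in> cball 0 1" "w \<in> cball 0 1" "\<eta> \<le> cmod (z - w)" for z w
  proof (rule ccontr)
    assume "\<not> ?thesis"
    moreover have "\<Psi> z \<in> cball 0 1" "\<Psi> w \<in> cball 0 1" using homeomorphism_image1[OF G] zw by blast+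
    ultimately have "dist (G (\<Psi> z)) (G (\<Psi> w)) < \<eta>" by (intro \<mu>(2)) (auto simp: dist_norm)
    then show False using zw homeomorphism_apply1[OF G] by (simp add: dist_norm)
  qed
  then show ?thesis using \<mu>(1) by blast
qed

lemma lipschitz:
  obtains L where "1 \<le> L" "\<And>z. z \<in> cball 0 1 \<Longrightarrow> norm (D z) \<le> L"
    "\<And>z w. z \<in> cball 0 1 \<Longrightarrow> w \<in> cball 0 1 \<Longrightarrow> cmod (\<Psi> z - \<Psi> w) \<le> L * cmod (z - w)"
proof -
  have "bounded (D ` cball 0 1)"
    using cont_D by (intro compact_imp_bounded compact_continuous_image) auto
  then obtain L0 where "\<forall>z\<in>cball 0 1. norm (D z) \<le> L0" unfolding bounded_iff by blast
  then have L: "\<And>z. z \<in> cball 0 1 \<Longrightarrow> norm (D z) \<le> max 1 L0" by fastforce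
  moreover have "cmod (\<Psi> z - \<Psi> w) \<le> max 1 L0 * cmod (z - w)"
    if "z \<in> cball 0 1" "w \<in> cball 0 1" for z w
    using convex_cball deriv L[unfolded norm_blinfun.rep_eq] that by (rule differentiable_bound)
  ultimately show ?thesis by (intro that[of "max 1 L0"]) auto
qed

text \<open>
  The derivative is uniformly continuous on the closed disc, and the mean value inequality on
  the segment from \<open>w\<close> to \<open>z\<close> turns this into a first-order expansion whose error is uniform in the
  base point. The estimates that involve the radial coefficient rest on it.
\<close>
lemma uniform_linear_approximation:
  assumes "0 < \<epsilon>"
  shows "\<exists>\<eta>>0. (\<forall>z\<in>cball 0 1. \<forall>w\<in>cball 0 1. cmod (z - w) < \<eta> \<longrightarrow>
    cmod (\<Psi> z - \<Psi> w - D w (z - w)) \<le> \<epsilon> * cmod (z - w) \<and> norm (D z - D w) \<le> \<epsilon>)"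
proof -
  have "uniformly_continuous_on (cball 0 1) D"
    using cont_D compact_cball by (rule compact_uniformly_continuous)
  then obtain \<eta> where \<eta>: "0 < \<eta>" "\<And>x y. x \<in> cball 0 1 \<Longrightarrow> y \<in> cball 0 1 \<Longrightarrow> dist y x < \<eta> \<Longrightarrow> dist (D y) (D x) < \<epsilon>"
    using assms unfolding uniformly_continuous_on_def by metis
  have D: "norm (D z - D w) \<le> \<epsilon>" if "z \<in> cball 0 1" "w \<in> cball 0 1" "cmod (z - w) < \<eta>" for z w
    using \<eta>(2)[OF that(2,1)] that(3) by (simp add: dist_norm)
  have "cmod (\<Psi> z - \<Psi> w - D w (z - w)) \<le> \<epsilon> * cmod (z - w)"
    if zw: "z \<in> cball 0 1" "w \<in> cball 0 1" "cmod (z - w) < \<eta>" for z w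
  proof -
    let ?S = "closed_segment w z"
    have S: "?S \<subseteq> cball 0 1" using zw by (intro closed_segment_subset convex_cball)
    have "cmod ((\<Psi> z - D w z) - (\<Psi> w - D w w)) \<le> \<epsilon> * cmod (z - w)"
    proof (rule differentiable_bound[where S = ?S and f' = "\<lambda>x v. D x v - D w v"])
      fix x assume x: "x \<in> ?S"
      have "(\<Psi> has_derivative D x) (at x within ?S)"
        using deriv S x has_derivative_subset by blast
      then show "((\<lambda>x. \<Psi> x - D w x) has_derivative (\<lambda>v. D x v - D w v)) (at x within ?S)"
        by (intro has_derivative_diff bounded_linear.has_derivative[OF blinfun.bounded_linear_right] has_derivative_ident)
      have "cmod (x - w) \<le> cmod (z - w)" using segment_bound(1)[OF x] by (simp add: norm_minus_commute)
      then have "norm (D x - D w) \<le> \<epsilon>" using zw x S by (intro D) auto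
      then show "onorm (\<lambda>v. D x v - D w v) \<le> \<epsilon>"
        by (simp add: norm_blinfun.rep_eq minus_blinfun.rep_eq)
    qed auto
    then show ?thesis by (simp add: blinfun.diff_right algebra_simps)
  qed
  then show ?thesis using D \<eta>(1) by blast
qed

text \<open>
  Differentiate \<open>\<Psi> (cis t * \<zeta>) = cis t * \<zeta>\<close> at \<open>t = 0\<close>.
\<close>
lemma tangential_derivative:
  assumes "\<zeta> \<in> \<T>" shows "D \<zeta> (\<i> * \<zeta>) = \<i> * \<zeta>"
proof -
  have c: "((\<lambda>t. cis t * \<zeta>) has_vector_derivative (\<i> * \<zeta>)) (at 0)"
    unfolding has_vector_derivative_def
    by (auto intro!: derivative_eq_intros simp: fun_eq_iff scaleR_conv_of_real)
  have sub: "range (\<lambda>t. cis t * \<zeta>) \<subseteq> cball 0 1" using assms by (auto simp: norm_mult)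
  have z: "\<zeta> \<in> cball 0 1" using assms by auto
  have "(\<Psi> has_derivative D \<zeta>) (at (cis 0 * \<zeta>) within range (\<lambda>t. cis t * \<zeta>))"
    using has_derivative_subset[OF deriv[OF z] sub] by simp
  from diff_chain_within[OF c[unfolded has_vector_derivative_def] this]
  have "((\<lambda>t. \<Psi> (cis t * \<zeta>)) has_vector_derivative D \<zeta> (\<i> * \<zeta>)) (at 0)"
    unfolding has_vector_derivative_def by (simp add: o_def blinfun.scaleR_right)
  moreover have "\<Psi> (cis t * \<zeta>) = cis t * \<zeta>" for t
    using assms by (intro boundary) (simp add: norm_mult)
  ultimately have "((\<lambda>t. cis t * \<zeta>) has_vector_derivative D \<zeta> (\<i> * \<zeta>)) (at 0)" by simp
  then show ?thesis using c by (rule vector_derivative_unique_at)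
qed

lemma one_minus_cmod_le:
  obtains C where "0 < C" "\<And>z. z \<in> \<D> \<Longrightarrow> 1 - (cmod (\<Psi> z))\<^sup>2 \<le> C * (1 - (cmod z)\<^sup>2)"
proof -
  obtain L where L: "1 \<le> L" "\<And>z w. z \<in> cball 0 1 \<Longrightarrow> w \<in> cball 0 1 \<Longrightarrow> cmod (\<Psi> z - \<Psi> w) \<le> L * cmod (z - w)"
    using lipschitz by metis
  have "1 - (cmod (\<Psi> z))\<^sup>2 \<le> 2 * L * (1 - (cmod z)\<^sup>2)" if z: "z \<in> \<D>" for z
  proof -
    have z': "z \<in> cball 0 1" using z by simp
    obtain \<zeta> where \<zeta>: "\<zeta> \<in> \<T>" "cmod (z - \<zeta>) = 1 - cmod z" by (rule nearest_circle_point[OF z'])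
    have "1 - cmod (\<Psi> z) \<le> cmod (\<Psi> z - \<zeta>)"
      using norm_triangle_ineq2[of \<zeta> "\<Psi> z"] \<zeta>(1) by (simp add: norm_minus_commute)
    also have "\<dots> \<le> L * (1 - cmod z)"
      using L(2)[OF z', of \<zeta>] boundary[OF \<zeta>(1)] \<zeta> by auto
    finally have 1: "1 - cmod (\<Psi> z) \<le> L * (1 - cmod z)" .
    have "1 - (cmod (\<Psi> z))\<^sup>2 \<le> 2 * (1 - cmod (\<Psi> z))"
      using zero_le_power2[of "1 - cmod (\<Psi> z)"] by (simp add: power2_eq_square algebra_simps)
    also have "\<dots> \<le> 2 * (L * (1 - cmod z))" using 1 by simp
    also have "\<dots> \<le> 2 * (L * (1 - (cmod z)\<^sup>2))"
      using L(1) z by (intro mult_left_mono) (auto simp: power2_eq_square mult_left_le)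
    finally show ?thesis by simp
  qed
  then show ?thesis using L(1) by (intro that[of "2 * L"]) auto
qed

text \<open>
  At the point at distance \<open>s\<close> from \<open>\<zeta>\<close> on its radius, \<open>1 - \<bar>\<Psi> z\<bar>\<close> is at most \<open>s * a\<close> up to an error
  \<open>s * c / 4\<close>, and the hypothesis forces it to be at least \<open>s * c / 2\<close>.
\<close>
lemma radial_coeff_ge:
  assumes \<zeta>: "\<zeta> \<in> \<T>" and c: "0 < c"
    and low: "\<And>z. z \<in> \<D> \<Longrightarrow> c * (1 - (cmod z)\<^sup>2) \<le> 1 - (cmod (\<Psi> z))\<^sup>2"
  shows "c / 4 \<le> radial_coeff \<Psi> \<zeta>"
proof -
  have \<zeta>c: "\<zeta> \<in> cball 0 1" and n: "cmod \<zeta> = 1" using \<zeta> by auto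
  obtain \<eta> where \<eta>: "0 < \<eta>" "\<And>z w. z \<in> cball 0 1 \<Longrightarrow> w \<in> cball 0 1 \<Longrightarrow> cmod (z - w) < \<eta> \<Longrightarrow>
    cmod (\<Psi> z - \<Psi> w - D w (z - w)) \<le> c / 4 * cmod (z - w)"
    using uniform_linear_approximation[of "c / 4"] c by auto
  define s where "s = min (1/2) (\<eta> / 2)"
  have s: "0 < s" "s < 1" "s < \<eta>" using \<eta>(1) by (auto simp: s_def)
  define z where "z = (1 - s) *\<^sub>R \<zeta>"
  have nz: "cmod z = 1 - s" using s n by (simp add: z_def)
  have d: "z - \<zeta> = - s *\<^sub>R \<zeta>" by (simp add: z_def algebra_simps)
  have nd: "cmod (z - \<zeta>) = s" unfolding d using s n by simp
  let ?e = "\<Psi> z - \<zeta> + s *\<^sub>R D \<zeta> \<zeta>"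
  have "cmod ?e \<le> c / 4 * s"
    using \<eta>(2)[of z \<zeta>] \<zeta>c nz s boundary[OF \<zeta>]
    unfolding nd unfolding d by (simp add: blinfun.scaleR_right blinfun.minus_right)
  moreover have "Re (cnj \<zeta> * ?e) = Re (cnj \<zeta> * \<Psi> z) - 1 + s * radial_coeff \<Psi> \<zeta>"
  proof -
    have "cnj \<zeta> * \<zeta> = 1" using complex_norm_square[of \<zeta>] n by (simp add: mult.commute)
    then show ?thesis
      by (simp add: radial_coeff_def D_disc[OF \<zeta>c] distrib_left right_diff_distrib del: times_complex.sel)
  qed
  moreover have "\<bar>Re (cnj \<zeta> * ?e)\<bar> \<le> cmod ?e"
    using abs_Re_le_cmod[of "cnj \<zeta> * ?e"] n by (simp add: norm_mult del: times_complex.sel)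
  moreover have "Re (cnj \<zeta> * \<Psi> z) \<le> cmod (\<Psi> z)"
    using complex_Re_le_cmod[of "cnj \<zeta> * \<Psi> z"] n by (simp add: norm_mult del: times_complex.sel)
  ultimately have 1: "1 - cmod (\<Psi> z) \<le> s * radial_coeff \<Psi> \<zeta> + c / 4 * s" by linarith
  have zD: "z \<in> \<D>" using nz s by simp
  have "c * s \<le> c * (1 - (cmod z)\<^sup>2)"
    using c s unfolding nz by (intro mult_left_mono) (auto simp: power2_eq_square algebra_simps mult_left_le)
  also have "\<dots> \<le> 1 - (cmod (\<Psi> z))\<^sup>2" by (rule low[OF zD])
  also have "\<dots> \<le> 2 * (1 - cmod (\<Psi> z))"
    using zero_le_power2[of "1 - cmod (\<Psi> z)"] by (simp add: power2_eq_square algebra_simps)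
  finally have "s * (c / 4) \<le> s * radial_coeff \<Psi> \<zeta>" using 1 by (simp add: algebra_simps)
  then show ?thesis using s(1) by simp
qed

end

text \<open>
  In the orthonormal basis \<open>\<zeta>, \<i> * \<zeta>\<close> the second column is \<open>(0, 1)\<close>, so the determinant is the
  remaining diagonal entry.
\<close>
lemma det_real_matrix_fixing_tangent:
  assumes lin: "linear L" and n: "cmod \<zeta> = 1" and tan: "L (\<i> * \<zeta>) = \<i> * \<zeta>"
  shows "det (real_matrix L) = Re (cnj \<zeta> * L \<zeta>)"
proof -
  define x y p q r s where "x = Re \<zeta>" and "y = Im \<zeta>" and "p = Re (L 1)" and "q = Im (L 1)"
    and "r = Re (L \<i>)" and "s = Im (L \<i>)"
  note defs = x_def y_def p_def q_def r_def s_def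
  have L: "L v = Re v *\<^sub>R L 1 + Im v *\<^sub>R L \<i>" for v
  proof -
    have "v = Re v *\<^sub>R 1 + Im v *\<^sub>R \<i>" by (simp add: complex_eq_iff)
    then show ?thesis using linear_add[OF lin] linear_scale[OF lin] by metis
  qed
  have 1: "x * x + y * y = 1" using n by (simp add: defs cmod_def power2_eq_square)
  have "L (\<i> * \<zeta>) = (- y) *\<^sub>R L 1 + x *\<^sub>R L \<i>" using L[of "\<i> * \<zeta>"] by (simp add: defs)
  with tan have 2: "- y * p + x * r = - y" "- y * q + x * s = x"
    by (simp_all add: defs complex_eq_iff)
  have "Re (cnj \<zeta> * L \<zeta>) = x * (x * p + y * r) + y * (x * q + y * s)"
    unfolding L[of \<zeta>] by (simp add: defs)
  moreover have "det (real_matrix L) = p * s - r * q"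
    by (simp add: real_matrix_def det_2 defs)
  moreover have "p * s - r * q = x * (x * p + y * r) + y * (x * q + y * s)"
    using 1 2 by algebra
  ultimately show ?thesis by simp
qed

context C1_disc_homeo begin

lemma det_D_disc:
  assumes "\<zeta> \<in> \<T>" shows "det (real_matrix (D_disc \<Psi> \<zeta>)) = radial_coeff \<Psi> \<zeta>"
proof -
  have z: "\<zeta> \<in> cball 0 1" and n: "cmod \<zeta> = 1" using assms by auto
  show ?thesis
    unfolding radial_coeff_def D_disc[OF z]
    using n tangential_derivative[OF assms]
    by (intro det_real_matrix_fixing_tangent bounded_linear.linear[OF blinfun.bounded_linear_right])
qed

lemma continuous_on_radial_coeff: "continuous_on \<T> (radial_coeff \<Psi>)"
proof -
  have "continuous_on \<T> D" using cont_D by (rule continuous_on_subset) auto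
  then have "continuous_on \<T> (\<lambda>\<zeta>. D \<zeta> \<zeta>)"
    by (rule blinfun.continuous_on) (rule continuous_on_id)
  then have "continuous_on \<T> (\<lambda>\<zeta>. Re (cnj \<zeta> * D \<zeta> \<zeta>))"
    by (intro continuous_on_Re continuous_on_mult continuous_on_cnj continuous_on_id)
  then show ?thesis
    by (rule continuous_on_eq) (simp add: radial_coeff_def D_disc)
qed

lemma INF_radial_coeff_pos_iff:
  "0 < (INF \<zeta>\<in>\<T>. radial_coeff \<Psi> \<zeta>) \<longleftrightarrow> (\<forall>\<zeta>\<in>\<T>. 0 < radial_coeff \<Psi> \<zeta>)"
proof
  have "bounded (radial_coeff \<Psi> ` \<T>)"
    by (intro compact_imp_bounded compact_continuous_image continuous_on_radial_coeff) simp
  then have bdd: "bdd_below (radial_coeff \<Psi> ` \<T>)" by (rule bounded_imp_bdd_below)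
  show "\<forall>\<zeta>\<in>\<T>. 0 < radial_coeff \<Psi> \<zeta>" if "0 < (INF \<zeta>\<in>\<T>. radial_coeff \<Psi> \<zeta>)"
    using cINF_lower[OF bdd] that less_le_trans by blast
  have ne: "\<T> \<noteq> {}" by simp
  obtain \<zeta>0 where \<zeta>0: "\<zeta>0 \<in> \<T>" "\<forall>\<zeta>\<in>\<T>. radial_coeff \<Psi> \<zeta>0 \<le> radial_coeff \<Psi> \<zeta>"
    using continuous_attains_inf[OF compact_sphere ne continuous_on_radial_coeff] by blast
  then have "radial_coeff \<Psi> \<zeta>0 \<le> (INF \<zeta>\<in>\<T>. radial_coeff \<Psi> \<zeta>)"
    by (intro cINF_greatest ne) blast
  then show "0 < (INF \<zeta>\<in>\<T>. radial_coeff \<Psi> \<zeta>)" if "\<forall>\<zeta>\<in>\<T>. 0 < radial_coeff \<Psi> \<zeta>"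
    using that \<zeta>0(1) less_le_trans by blast
qed

text \<open>
  Near the circle this is the first-order expansion at the nearest circle point \<open>\<zeta>\<close>: with \<open>s = 1 - \<bar>z\<bar>\<close>,
  \<open>\<Psi> z\<close> is \<open>\<zeta> * (1 - s * u)\<close> up to \<open>m / 4 * s\<close>, where \<open>u\<close> has real part at least \<open>m\<close> and modulus at most
  \<open>L\<close>. For \<open>s \<le> m / (2 * L\<^sup>2)\<close> the quadratic term is absorbed. On the remaining compact disc
  \<open>1 - \<bar>\<Psi> z\<bar>\<^sup>2\<close> has a positive minimum.
\<close>
lemma one_minus_cmod_ge:
  assumes m: "0 < m" and rad: "\<And>\<zeta>. \<zeta> \<in> \<T> \<Longrightarrow> m \<le> radial_coeff \<Psi> \<zeta>"
  obtains c where "0 < c" "\<And>z. z \<in> \<D> \<Longrightarrow> c * (1 - (cmod z)\<^sup>2) \<le> 1 - (cmod (\<Psi> z))\<^sup>2"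
proof -
  obtain L where L: "1 \<le> L" "\<And>z. z \<in> cball 0 1 \<Longrightarrow> norm (D z) \<le> L"
    using lipschitz by metis
  obtain \<eta>0 where \<eta>0: "0 < \<eta>0" "\<And>z w. z \<in> cball 0 1 \<Longrightarrow> w \<in> cball 0 1 \<Longrightarrow> cmod (z - w) < \<eta>0 \<Longrightarrow>
    cmod (\<Psi> z - \<Psi> w - D w (z - w)) \<le> m / 4 * cmod (z - w)"
    using uniform_linear_approximation[of "m / 4"] m by auto
  define \<eta> where "\<eta> = min \<eta>0 (m / (2 * L\<^sup>2))"
  have L2: "0 < L\<^sup>2" using L(1) by simp
  have \<eta>: "0 < \<eta>" using \<eta>0(1) m L2 by (simp add: \<eta>_def)
  have near: "m / 4 * (1 - (cmod z)\<^sup>2) \<le> 1 - (cmod (\<Psi> z))\<^sup>2" if z: "z \<in> \<D>" and s\<eta>: "1 - cmod z < \<eta>" for z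
  proof -
    define s where "s = 1 - cmod z"
    have zc: "z \<in> cball 0 1" using z by simp
    have s: "0 < s" "s < \<eta>0" "s \<le> m / (2 * L\<^sup>2)" using z s\<eta> by (auto simp: s_def \<eta>_def)
    obtain \<zeta> where \<zeta>: "\<zeta> \<in> \<T>" "z - \<zeta> = - (s *\<^sub>R \<zeta>)" "cmod (z - \<zeta>) = s"
      using nearest_circle_point[OF zc] unfolding s_def by metis
    have \<zeta>c: "\<zeta> \<in> cball 0 1" and n: "cmod \<zeta> = 1" using \<zeta> by auto
    define u where "u = cnj \<zeta> * D \<zeta> \<zeta>"
    have Re_u: "m \<le> Re u" using rad[OF \<zeta>(1)] by (simp add: u_def radial_coeff_def D_disc[OF \<zeta>c])
    have "cmod (D \<zeta> \<zeta>) \<le> norm (D \<zeta>) * cmod \<zeta>" by (rule norm_blinfun)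
    also have "\<dots> \<le> L" using L(2)[OF \<zeta>c] n by simp
    finally have u: "cmod u \<le> L" using n by (simp add: u_def norm_mult)
    have sL: "s * L\<^sup>2 \<le> m / 2" using s(3) L2 by (simp add: pos_le_divide_eq field_simps)
    have mL: "m \<le> L" using Re_u u complex_Re_le_cmod[of u] by linarith
    have "s * m \<le> 1"
    proof -
      have "s * m * m \<le> s * L\<^sup>2"
        unfolding power2_eq_square mult.assoc using mL m s by (intro mult_mono) auto
      also have "\<dots> \<le> m / 2" by (rule sL)
      finally show ?thesis using m by (simp add: mult_le_cancel_right)
    qed
    have sq: "(cmod (1 - s *\<^sub>R u))\<^sup>2 = 1 - 2 * s * Re u + s * (s * (cmod u)\<^sup>2)"
      unfolding cmod_power2 by (simp add: power2_eq_square algebra_simps)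
    have "(cmod u)\<^sup>2 \<le> L\<^sup>2" using u by (intro power_mono) auto
    then have "s * (cmod u)\<^sup>2 \<le> m / 2" using sL s(1) by (smt (verit) mult_left_mono)
    then have "s * (s * (cmod u)\<^sup>2) \<le> s * (m / 2)" using s(1) by (intro mult_left_mono) auto
    moreover have "s * m \<le> s * Re u" using Re_u s(1) by (intro mult_left_mono) auto
    ultimately have "(cmod (1 - s *\<^sub>R u))\<^sup>2 \<le> 1 - 3/2 * (s * m)" unfolding sq by (simp add: algebra_simps)
    also have "\<dots> \<le> (1 - 3/4 * (s * m))\<^sup>2"
      using zero_le_power2[of "3/4 * (s * m)"] by (simp add: power2_eq_square algebra_simps)
    finally have a: "cmod (1 - s *\<^sub>R u) \<le> 1 - 3/4 * (s * m)"
      by (rule power2_le_imp_le) (use \<open>s * m \<le> 1\<close> in linarith)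
    have "cmod (\<Psi> z - \<zeta> + s *\<^sub>R D \<zeta> \<zeta>) \<le> m / 4 * s"
      using \<eta>0(2)[OF zc \<zeta>c] s(2) boundary[OF \<zeta>(1)]
      unfolding \<zeta>(3) unfolding \<zeta>(2) by (simp add: blinfun.scaleR_right blinfun.minus_right)
    moreover have "cmod (\<zeta> - s *\<^sub>R D \<zeta> \<zeta>) = cmod (1 - s *\<^sub>R u)"
    proof -
      have "\<zeta> * cnj \<zeta> = 1" using complex_norm_square[of \<zeta>] n by simp
      then have "\<zeta> - s *\<^sub>R D \<zeta> \<zeta> = \<zeta> * (1 - s *\<^sub>R u)"
        by (simp add: u_def right_diff_distrib flip: mult.assoc)
      then show ?thesis using n by (simp only: norm_mult mult_1)
    qed
    moreover have "cmod (\<Psi> z) \<le> cmod (\<Psi> z - \<zeta> + s *\<^sub>R D \<zeta> \<zeta>) + cmod (\<zeta> - s *\<^sub>R D \<zeta> \<zeta>)"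
      using norm_triangle_ineq[of "\<Psi> z - \<zeta> + s *\<^sub>R D \<zeta> \<zeta>" "\<zeta> - s *\<^sub>R D \<zeta> \<zeta>"] by simp
    ultimately have b: "m / 2 * s \<le> 1 - cmod (\<Psi> z)" using a by (simp add: algebra_simps)
    have "1 - (cmod z)\<^sup>2 \<le> 2 * s"
      using zero_le_power2[of "1 - cmod z"] by (simp add: s_def power2_eq_square algebra_simps)
    then have "m / 4 * (1 - (cmod z)\<^sup>2) \<le> m / 4 * (2 * s)" using m by (intro mult_left_mono) auto
    also have "\<dots> \<le> 1 - cmod (\<Psi> z)" using b by simp
    also have "\<dots> \<le> 1 - (cmod (\<Psi> z))\<^sup>2"
      using maps_disc[OF z] by (simp add: power2_eq_square mult_left_le)
    finally show ?thesis .
  qed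
  define r where "r = max 0 (1 - \<eta>)"
  have r: "0 \<le> r" "r < 1" using \<eta> by (auto simp: r_def)
  have sub: "cball 0 r \<subseteq> \<D>" "cball 0 r \<subseteq> cball 0 1" using r by auto
  have ne: "cball (0::complex) r \<noteq> {}" using r by simp
  have "continuous_on (cball 0 r) (\<lambda>z. 1 - (cmod (\<Psi> z))\<^sup>2)"
    by (intro continuous_intros continuous_on_subset[OF cont sub(2)])
  then obtain z0 where z0: "z0 \<in> cball 0 r" "\<And>z. z \<in> cball 0 r \<Longrightarrow> 1 - (cmod (\<Psi> z0))\<^sup>2 \<le> 1 - (cmod (\<Psi> z))\<^sup>2"
    using continuous_attains_inf[OF compact_cball ne] by blast
  define \<mu> where "\<mu> = 1 - (cmod (\<Psi> z0))\<^sup>2"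
  have \<mu>: "0 < \<mu>" unfolding \<mu>_def using one_minus_cmod_sq_pos maps_disc sub(1) z0(1) by blast
  show ?thesis
  proof
    show "0 < min (m / 4) \<mu>" using m \<mu> by simp
    fix z assume z: "z \<in> \<D>"
    have p: "0 < 1 - (cmod z)\<^sup>2" by (rule one_minus_cmod_sq_pos[OF z])
    show "min (m / 4) \<mu> * (1 - (cmod z)\<^sup>2) \<le> 1 - (cmod (\<Psi> z))\<^sup>2"
    proof (cases "1 - cmod z < \<eta>")
      case True
      have "min (m / 4) \<mu> * (1 - (cmod z)\<^sup>2) \<le> m / 4 * (1 - (cmod z)\<^sup>2)"
        using p by (intro mult_right_mono) auto
      then show ?thesis using near[OF z True] by linarith
    next
      case False
      then have "\<mu> \<le> 1 - (cmod (\<Psi> z))\<^sup>2" unfolding \<mu>_def by (intro z0(2)) (auto simp: r_def)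
      moreover have "min (m / 4) \<mu> * (1 - (cmod z)\<^sup>2) \<le> \<mu> * 1"
        using p \<mu> by (intro mult_mono) auto
      ultimately show ?thesis by linarith
    qed
  qed
qed

text \<open>
  For \<open>v = s * \<zeta> + t * \<i> * \<zeta>\<close> the radial part of \<open>D \<zeta> v\<close> controls \<open>s\<close> through the radial coefficient,
  and then \<open>t\<close> is controlled because the tangent vector is fixed.
\<close>
lemma derivative_bounded_below:
  assumes m: "0 < m" and rad: "\<And>\<zeta>. \<zeta> \<in> \<T> \<Longrightarrow> m \<le> radial_coeff \<Psi> \<zeta>"
  obtains \<kappa> where "0 < \<kappa>" "\<And>\<zeta> v. \<zeta> \<in> \<T> \<Longrightarrow> \<kappa> * cmod v \<le> cmod (D \<zeta> v)"
proof -
  obtain L where L: "1 \<le> L" "\<And>z. z \<in> cball 0 1 \<Longrightarrow> norm (D z) \<le> L"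
    using lipschitz by metis
  define K where "K = 1 + (1 + L) / m"
  have K: "0 < K" using L(1) m by (simp add: K_def add_pos_nonneg)
  have "cmod v \<le> K * cmod (D \<zeta> v)" if \<zeta>: "\<zeta> \<in> \<T>" for \<zeta> v
  proof -
    have \<zeta>c: "\<zeta> \<in> cball 0 1" and n: "cmod \<zeta> = 1" using \<zeta> by auto
    have n1: "\<zeta> * cnj \<zeta> = 1" using complex_norm_square[of \<zeta>] n by simp
    define s t where "s = Re (cnj \<zeta> * v)" and "t = Im (cnj \<zeta> * v)"
    have v: "v = s *\<^sub>R \<zeta> + t *\<^sub>R (\<i> * \<zeta>)"
    proof -
      have "v = \<zeta> * (cnj \<zeta> * v)" using n1 by (simp flip: mult.assoc)
      also have "cnj \<zeta> * v = of_real s + \<i> * of_real t" unfolding s_def t_def by (rule complex_eq)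
      finally show ?thesis by (simp add: scaleR_conv_of_real algebra_simps)
    qed
    have Dv: "D \<zeta> v = s *\<^sub>R D \<zeta> \<zeta> + t *\<^sub>R (\<i> * \<zeta>)"
      using tangential_derivative[OF \<zeta>]
      by (subst v) (simp add: blinfun.add_right blinfun.scaleR_right)
    have Dz: "cmod (D \<zeta> \<zeta>) \<le> L"
      using norm_blinfun[of "D \<zeta>" \<zeta>] L(2)[OF \<zeta>c] n by simp
    have "Re (cnj \<zeta> * D \<zeta> v) = s * radial_coeff \<Psi> \<zeta>"
    proof -
      have "cnj \<zeta> * D \<zeta> v = s *\<^sub>R (cnj \<zeta> * D \<zeta> \<zeta>) + t *\<^sub>R (\<i> * (\<zeta> * cnj \<zeta>))"
        unfolding Dv by (simp add: algebra_simps)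
      then show ?thesis unfolding n1 by (simp add: radial_coeff_def D_disc[OF \<zeta>c] del: times_complex.sel)
    qed
    then have "\<bar>s\<bar> * radial_coeff \<Psi> \<zeta> \<le> cmod (D \<zeta> v)"
      using abs_Re_le_cmod[of "cnj \<zeta> * D \<zeta> v"] n rad[OF \<zeta>] m
      by (simp add: norm_mult abs_mult del: times_complex.sel)
    moreover have "\<bar>s\<bar> * m \<le> \<bar>s\<bar> * radial_coeff \<Psi> \<zeta>" using rad[OF \<zeta>] by (intro mult_left_mono) auto
    ultimately have s: "\<bar>s\<bar> \<le> cmod (D \<zeta> v) / m" using m by (simp add: pos_le_divide_eq)
    have "cmod (t *\<^sub>R (\<i> * \<zeta>)) \<le> cmod (D \<zeta> v) + cmod (s *\<^sub>R D \<zeta> \<zeta>)"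
      using norm_triangle_ineq4[of "D \<zeta> v" "s *\<^sub>R D \<zeta> \<zeta>"] Dv by simp
    then have "\<bar>t\<bar> \<le> cmod (D \<zeta> v) + \<bar>s\<bar> * cmod (D \<zeta> \<zeta>)" using n by (simp add: norm_mult)
    also have "\<bar>s\<bar> * cmod (D \<zeta> \<zeta>) \<le> \<bar>s\<bar> * L" using Dz by (intro mult_left_mono) auto
    finally have t: "\<bar>t\<bar> \<le> cmod (D \<zeta> v) + \<bar>s\<bar> * L" by simp
    have "cmod v \<le> \<bar>s\<bar> + \<bar>t\<bar>"
      using norm_triangle_ineq[of "s *\<^sub>R \<zeta>" "t *\<^sub>R (\<i> * \<zeta>)"] n unfolding v[symmetric] by (simp add: norm_mult)
    also have "\<dots> \<le> cmod (D \<zeta> v) + \<bar>s\<bar> * (1 + L)" using t by (simp add: algebra_simps)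
    also have "\<bar>s\<bar> * (1 + L) \<le> cmod (D \<zeta> v) / m * (1 + L)" using s L(1) by (intro mult_right_mono) auto
    finally show ?thesis by (simp add: K_def algebra_simps)
  qed
  then show ?thesis
    using K by (intro that[of "1 / K"]) (auto simp: pos_divide_le_eq mult.commute)
qed

text \<open>
  The linear part at \<open>w\<close> differs little from the one at the nearest circle point, which is invertible with a
  uniform bound, and the first-order error is small on the same scale.
\<close>
lemma locally_bounded_below_near_circle:
  assumes m: "0 < m" and rad: "\<And>\<zeta>. \<zeta> \<in> \<T> \<Longrightarrow> m \<le> radial_coeff \<Psi> \<zeta>"
  obtains \<kappa> \<eta> where "0 < \<kappa>" "0 < \<eta>" "\<And>z w. z \<in> cball 0 1 \<Longrightarrow> w \<in> cball 0 1 \<Longrightarrow>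
    1 - cmod w < \<eta> \<Longrightarrow> cmod (z - w) < \<eta> \<Longrightarrow> \<kappa> * cmod (z - w) \<le> cmod (\<Psi> z - \<Psi> w)"
proof -
  obtain \<kappa> where \<kappa>: "0 < \<kappa>" "\<And>\<zeta> v. \<zeta> \<in> \<T> \<Longrightarrow> \<kappa> * cmod v \<le> cmod (D \<zeta> v)"
    using derivative_bounded_below[OF m rad] by metis
  obtain \<eta> where \<eta>: "0 < \<eta>"
    "\<And>z w. z \<in> cball 0 1 \<Longrightarrow> w \<in> cball 0 1 \<Longrightarrow> cmod (z - w) < \<eta> \<Longrightarrow>
      cmod (\<Psi> z - \<Psi> w - D w (z - w)) \<le> \<kappa> / 4 * cmod (z - w)"
    "\<And>z w. z \<in> cball 0 1 \<Longrightarrow> w \<in> cball 0 1 \<Longrightarrow> cmod (z - w) < \<eta> \<Longrightarrow> norm (D z - D w) \<le> \<kappa> / 4"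
    using uniform_linear_approximation[of "\<kappa> / 4"] \<kappa>(1) by auto
  have "\<kappa> / 2 * cmod (z - w) \<le> cmod (\<Psi> z - \<Psi> w)"
    if zw: "z \<in> cball 0 1" "w \<in> cball 0 1" "1 - cmod w < \<eta>" "cmod (z - w) < \<eta>" for z w
  proof -
    obtain \<zeta> where \<zeta>: "\<zeta> \<in> \<T>" "cmod (w - \<zeta>) = 1 - cmod w" by (rule nearest_circle_point[OF zw(2)])
    have "norm (D w - D \<zeta>) \<le> \<kappa> / 4" using \<eta>(3)[OF zw(2), of \<zeta>] \<zeta> zw(3) by auto
    then have "cmod ((D w - D \<zeta>) (z - w)) \<le> \<kappa> / 4 * cmod (z - w)"
      using norm_blinfun[of "D w - D \<zeta>" "z - w"] mult_right_mono[of _ "\<kappa> / 4" "cmod (z - w)"]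
      by (meson norm_ge_zero order_trans)
    then have 1: "cmod (D w (z - w) - D \<zeta> (z - w)) \<le> \<kappa> / 4 * cmod (z - w)"
      by (simp add: blinfun.diff_left)
    have 2: "cmod (\<Psi> z - \<Psi> w - D w (z - w)) \<le> \<kappa> / 4 * cmod (z - w)"
      using \<eta>(2) zw by blast
    have "\<kappa> * cmod (z - w) \<le> cmod (D \<zeta> (z - w))" by (rule \<kappa>(2)[OF \<zeta>(1)])
    also have "\<dots> \<le> cmod (D w (z - w)) + cmod (D w (z - w) - D \<zeta> (z - w))"
      using norm_triangle_ineq4[of "D w (z - w)" "D w (z - w) - D \<zeta> (z - w)"] by simp
    also have "cmod (D w (z - w)) \<le> cmod (\<Psi> z - \<Psi> w) + cmod (\<Psi> z - \<Psi> w - D w (z - w))"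
      using norm_triangle_ineq4[of "\<Psi> z - \<Psi> w" "\<Psi> z - \<Psi> w - D w (z - w)"] by simp
    finally show ?thesis using 1 2 by simp
  qed
  then show ?thesis using \<kappa>(1) \<eta>(1) by (intro that[of "\<kappa> / 2" \<eta>]) auto
qed

end

section \<open>Preservation of interpolating sequences\<close>

text \<open>
  The two hypotheses match the two halves of uniform separation, so that each can be supplied by
  whichever property of the map is at hand.
\<close>
lemma uniformly_separated_transfer:
  assumes sum: "\<And>j k. j \<in> J \<Longrightarrow> k \<in> J \<Longrightarrow> codist (mu j) (mu k) \<le> K * codist (lam j) (lam k)"
    and sep: "\<And>\<epsilon>. 0 < \<epsilon> \<Longrightarrow> \<exists>\<delta>>0. \<forall>j\<in>J. \<forall>k\<in>J.
        codist (lam j) (lam k) \<le> 1 - \<epsilon> \<longrightarrow> codist (mu j) (mu k) \<le> 1 - \<delta>"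
    and K: "0 \<le> K" and us: "uniformly_separated J lam"
  shows "uniformly_separated J mu"
proof -
  obtain \<epsilon> C where \<epsilon>: "0 < \<epsilon>" "\<forall>j\<in>J. \<forall>k\<in>J. j \<noteq> k \<longrightarrow> codist (lam j) (lam k) \<le> 1 - \<epsilon>"
    and C: "\<forall>k\<in>J. \<forall>F. finite F \<longrightarrow> F \<subseteq> J \<longrightarrow> (\<Sum>j\<in>F. codist (lam j) (lam k)) \<le> C"
    using us unfolding uniformly_separated_def by metis
  obtain \<delta> where \<delta>: "0 < \<delta>" "\<forall>j\<in>J. \<forall>k\<in>J.
        codist (lam j) (lam k) \<le> 1 - \<epsilon> \<longrightarrow> codist (mu j) (mu k) \<le> 1 - \<delta>"
    using sep[OF \<epsilon>(1)] by blast
  have "(\<Sum>j\<in>F. codist (mu j) (mu k)) \<le> K * C" if k: "k \<in> J" and F: "finite F" "F \<subseteq> J" for k F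
  proof -
    have "(\<Sum>j\<in>F. codist (mu j) (mu k)) \<le> (\<Sum>j\<in>F. K * codist (lam j) (lam k))"
      using F k by (intro sum_mono sum) auto
    also have "\<dots> = K * (\<Sum>j\<in>F. codist (lam j) (lam k))" by (simp only: sum_distrib_left)
    also have "\<dots> \<le> K * C" using C k F K by (intro mult_left_mono) auto
    finally show ?thesis .
  qed
  then have "\<exists>C. \<forall>k\<in>J. \<forall>F. finite F \<longrightarrow> F \<subseteq> J \<longrightarrow> (\<Sum>j\<in>F. codist (mu j) (mu k)) \<le> C" by blast
  moreover have "\<exists>\<delta>>0. \<forall>j\<in>J. \<forall>k\<in>J. j \<noteq> k \<longrightarrow> codist (mu j) (mu k) \<le> 1 - \<delta>"
    using \<epsilon>(2) \<delta> by blast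
  ultimately show ?thesis unfolding uniformly_separated_def by blast
qed

lemma codist_le_mult_codist:
  assumes D: "z \<in> \<D>" "w \<in> \<D>" "z' \<in> \<D>" "w' \<in> \<D>" and C: "0 < C" and K: "0 < K"
    and z: "1 - (cmod z')\<^sup>2 \<le> C * (1 - (cmod z)\<^sup>2)" and w: "1 - (cmod w')\<^sup>2 \<le> C * (1 - (cmod w)\<^sup>2)"
    and d: "cmod (1 - cnj z * w) \<le> K * cmod (1 - cnj z' * w')"
  shows "codist z' w' \<le> C\<^sup>2 * K\<^sup>2 * codist z w"
proof -
  let ?d = "cmod (1 - cnj z * w)" and ?d' = "cmod (1 - cnj z' * w')"
  have pos: "0 < ?d" "0 < ?d'" using D cmod_one_minus_cnj_mult_bounds(1) by blast+
  have N: "(1 - (cmod z')\<^sup>2) * (1 - (cmod w')\<^sup>2) \<le> (C * (1 - (cmod z)\<^sup>2)) * (C * (1 - (cmod w)\<^sup>2))"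
    using z w C D[THEN one_minus_cmod_sq_pos] by (intro mult_mono mult_nonneg_nonneg) auto
  have "?d\<^sup>2 \<le> (K * ?d')\<^sup>2" using d by (intro power_mono) auto
  then have dd: "inverse (?d'\<^sup>2) \<le> K\<^sup>2 * inverse (?d\<^sup>2)"
    using pos by (simp add: power_mult_distrib field_simps)
  have "codist z' w' = (1 - (cmod z')\<^sup>2) * (1 - (cmod w')\<^sup>2) * inverse (?d'\<^sup>2)"
    by (simp add: codist_def divide_inverse)
  also have "\<dots> \<le> ((C * (1 - (cmod z)\<^sup>2)) * (C * (1 - (cmod w)\<^sup>2))) * (K\<^sup>2 * inverse (?d\<^sup>2))"
    by (rule mult_mono[OF N dd])
      (use C D[THEN one_minus_cmod_sq_pos] in \<open>auto intro!: mult_nonneg_nonneg\<close>)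
  also have "\<dots> = C\<^sup>2 * K\<^sup>2 * codist z w"
    by (simp only: codist_def divide_inverse power2_eq_square mult_ac)
  finally show ?thesis .
qed

lemma one_minus_codist_le_mult:
  assumes D: "z \<in> \<D>" "w \<in> \<D>" "z' \<in> \<D>" "w' \<in> \<D>" and A: "0 < A" and K: "0 < K"
    and zw: "cmod (z - w) \<le> A * cmod (z' - w')"
    and d: "cmod (1 - cnj z' * w') \<le> K * cmod (1 - cnj z * w)"
  shows "1 - codist z w \<le> (A * K)\<^sup>2 * (1 - codist z' w')"
proof -
  let ?d = "cmod (1 - cnj z * w)" and ?d' = "cmod (1 - cnj z' * w')"
  have pos: "0 < ?d" "0 < ?d'" using D cmod_one_minus_cnj_mult_bounds(1) by blast+
  have "inverse ?d \<le> K * inverse ?d'" using pos d by (simp add: field_simps)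
  then have "cmod (z - w) * inverse ?d \<le> (A * cmod (z' - w')) * (K * inverse ?d')"
    using zw pos A by (intro mult_mono) auto
  then have "(cmod (z - w) / ?d)\<^sup>2 \<le> (A * K * (cmod (z' - w') / ?d'))\<^sup>2"
    using pos by (intro power_mono) (auto simp: divide_inverse mult_ac)
  then show ?thesis
    unfolding one_minus_codist(1)[OF D(1,2)] one_minus_codist(1)[OF D(3,4)] power_mult_distrib .
qed

context C1_disc_homeo begin

text \<open>
  For the second inequality, a point is displaced by at most a multiple of its distance to the circle, hence of \<open>1 - \<bar>\<Psi> z\<bar>\<^sup>2\<close>, so \<open>\<bar>z - w\<bar>\<close> exceeds
  \<open>\<bar>\<Psi> z - \<Psi> w\<bar>\<close> only by terms that the right-hand side dominates.
\<close>
lemma cmod_one_minus_cnj_mult_comparable: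
  assumes c: "0 < c" and low: "\<And>z. z \<in> \<D> \<Longrightarrow> c * (1 - (cmod z)\<^sup>2) \<le> 1 - (cmod (\<Psi> z))\<^sup>2"
  obtains K where "0 < K"
    "\<And>z w. z \<in> \<D> \<Longrightarrow> w \<in> \<D> \<Longrightarrow> cmod (1 - cnj (\<Psi> z) * \<Psi> w) \<le> K * cmod (1 - cnj z * w)"
    "\<And>z w. z \<in> \<D> \<Longrightarrow> w \<in> \<D> \<Longrightarrow> cmod (1 - cnj z * w) \<le> K * cmod (1 - cnj (\<Psi> z) * \<Psi> w)"
proof -
  obtain L where L: "1 \<le> L" "\<And>z w. z \<in> cball 0 1 \<Longrightarrow> w \<in> cball 0 1 \<Longrightarrow> cmod (\<Psi> z - \<Psi> w) \<le> L * cmod (z - w)"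
    using lipschitz by metis
  obtain C where C: "0 < C" "\<And>z. z \<in> \<D> \<Longrightarrow> 1 - (cmod (\<Psi> z))\<^sup>2 \<le> C * (1 - (cmod z)\<^sup>2)"
    using one_minus_cmod_le by metis
  have sq: "1 - (cmod z)\<^sup>2 \<le> 2 * cmod (1 - cnj z * w)" "1 - (cmod w)\<^sup>2 \<le> 2 * cmod (1 - cnj z * w)"
    if "z \<in> \<D>" "w \<in> \<D>" for z w
    using cmod_one_minus_cnj_mult_bounds(2,3)[OF that] zero_le_power2[of "1 - cmod z"]
      zero_le_power2[of "1 - cmod w"] by (simp_all add: power2_eq_square algebra_simps)
  have up: "cmod (1 - cnj (\<Psi> z) * \<Psi> w) \<le> (2 * C + L) * cmod (1 - cnj z * w)"
    if zw: "z \<in> \<D>" "w \<in> \<D>" for z w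
  proof -
    let ?d = "cmod (1 - cnj z * w)"
    have "cmod (1 - cnj (\<Psi> z) * \<Psi> w) \<le> (1 - (cmod (\<Psi> z))\<^sup>2) + cmod (\<Psi> z - \<Psi> w)"
      using maps_disc zw by (intro cmod_one_minus_cnj_mult_bounds(5))
    also have "\<dots> \<le> C * (1 - (cmod z)\<^sup>2) + L * cmod (z - w)"
      using zw by (intro add_mono C(2) L(2)) auto
    also have "\<dots> \<le> C * (2 * ?d) + L * ?d"
      using sq(1)[OF zw] cmod_one_minus_cnj_mult_bounds(4)[OF zw] C(1) L(1)
      by (intro add_mono mult_left_mono) auto
    finally show ?thesis by (simp add: algebra_simps)
  qed
  have disp: "cmod (z - \<Psi> z) \<le> (L + 1) / c * (1 - (cmod (\<Psi> z))\<^sup>2)" if z: "z \<in> \<D>" for z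
  proof -
    have zc: "z \<in> cball 0 1" using z by simp
    obtain \<zeta> where \<zeta>: "\<zeta> \<in> \<T>" "cmod (z - \<zeta>) = 1 - cmod z" by (rule nearest_circle_point[OF zc])
    have "cmod (z - \<Psi> z) \<le> cmod (z - \<zeta>) + cmod (\<Psi> z - \<Psi> \<zeta>)"
      using norm_triangle_ineq4[of "z - \<zeta>" "\<Psi> z - \<zeta>"] boundary[OF \<zeta>(1)] by simp
    also have "\<dots> \<le> (1 - cmod z) + L * (1 - cmod z)"
      using L(2)[OF zc, of \<zeta>] \<zeta> by auto
    also have "\<dots> = (L + 1) * (1 - cmod z)" by (simp add: algebra_simps)
    also have "\<dots> \<le> (L + 1) * (1 - (cmod z)\<^sup>2)"
      using z L(1) by (intro mult_left_mono) (auto simp: power2_eq_square mult_left_le)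
    also have "\<dots> \<le> (L + 1) * ((1 - (cmod (\<Psi> z))\<^sup>2) / c)"
      using low[OF z] c L(1) by (intro mult_left_mono) (auto simp: pos_le_divide_eq mult.commute)
    finally show ?thesis by simp
  qed
  have down: "cmod (1 - cnj z * w) \<le> (2 / c + 1 + 4 * ((L + 1) / c)) * cmod (1 - cnj (\<Psi> z) * \<Psi> w)"
    if zw: "z \<in> \<D>" "w \<in> \<D>" for z w
  proof -
    let ?d = "cmod (1 - cnj (\<Psi> z) * \<Psi> w)"
    note m = maps_disc[OF zw(1)] maps_disc[OF zw(2)]
    have "1 - (cmod z)\<^sup>2 \<le> (1 - (cmod (\<Psi> z))\<^sup>2) / c"
      using low[OF zw(1)] c by (simp add: pos_le_divide_eq mult.commute)
    also have "\<dots> \<le> 2 * ?d / c" using sq(1)[OF m] c by (intro divide_right_mono) auto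
    finally have 1: "1 - (cmod z)\<^sup>2 \<le> 2 * ?d / c" .
    have Lc: "0 \<le> (L + 1) / c" using L(1) c by simp
    have 2: "cmod (z - \<Psi> z) \<le> (L + 1) / c * (2 * ?d)" "cmod (w - \<Psi> w) \<le> (L + 1) / c * (2 * ?d)"
      using disp[OF zw(1)] mult_left_mono[OF sq(1)[OF m] Lc]
        disp[OF zw(2)] mult_left_mono[OF sq(2)[OF m] Lc] by linarith+
    have "z - w = (z - \<Psi> z) + ((\<Psi> z - \<Psi> w) - (w - \<Psi> w))" by simp
    then have "cmod (z - w) \<le> cmod (z - \<Psi> z) + (cmod (\<Psi> z - \<Psi> w) + cmod (w - \<Psi> w))"
      by (metis norm_triangle_le norm_triangle_ineq4 add_left_mono)
    then have 3: "cmod (z - w) \<le> ?d + 2 * ((L + 1) / c * (2 * ?d))"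
      using 2 cmod_one_minus_cnj_mult_bounds(4)[OF m] by linarith
    have "cmod (1 - cnj z * w) \<le> 2 * ?d / c + (?d + 2 * ((L + 1) / c * (2 * ?d)))"
      using cmod_one_minus_cnj_mult_bounds(5)[OF zw] 1 3 by linarith
    also have "\<dots> = (2 / c + 1 + 4 * ((L + 1) / c)) * ?d" using c by (simp add: field_simps)
    finally show ?thesis .
  qed
  define K where "K = max (2 * C + L) (2 / c + 1 + 4 * ((L + 1) / c))"
  show ?thesis
  proof
    show "0 < K" using C(1) L(1) by (simp add: K_def less_max_iff_disj)
    fix z w assume zw: "z \<in> \<D>" "w \<in> \<D>"
    show "cmod (1 - cnj (\<Psi> z) * \<Psi> w) \<le> K * cmod (1 - cnj z * w)"
      by (rule order_trans[OF up[OF zw] mult_right_mono]) (simp_all add: K_def)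
    show "cmod (1 - cnj z * w) \<le> K * cmod (1 - cnj (\<Psi> z) * \<Psi> w)"
      by (rule order_trans[OF down[OF zw] mult_right_mono]) (simp_all add: K_def)
  qed
qed

text \<open>
  Pairs at Euclidean distance at least \<open>\<theta>\<close> are handled by compactness. In a closer pair \<open>w\<close> must be near
  the circle, because \<open>\<rho>(z, w) \<ge> sqrt \<epsilon>\<close> gives \<open>\<bar>z - w\<bar> \<ge> sqrt \<epsilon> * (1 - \<bar>w\<bar>)\<close>; there the local lower
  Lipschitz bound applies.
\<close>
lemma preserves_separation:
  assumes m: "0 < m" and rad: "\<And>\<zeta>. \<zeta> \<in> \<T> \<Longrightarrow> m \<le> radial_coeff \<Psi> \<zeta>"
    and K: "0 < K" "\<And>z w. z \<in> \<D> \<Longrightarrow> w \<in> \<D> \<Longrightarrow> cmod (1 - cnj (\<Psi> z) * \<Psi> w) \<le> K * cmod (1 - cnj z * w)"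
    and \<epsilon>: "0 < \<epsilon>"
  shows "\<exists>\<delta>>0. \<forall>z\<in>\<D>. \<forall>w\<in>\<D>. codist z w \<le> 1 - \<epsilon> \<longrightarrow> codist (\<Psi> z) (\<Psi> w) \<le> 1 - \<delta>"
proof -
  obtain \<kappa> \<eta> where \<kappa>: "0 < \<kappa>" and \<eta>: "0 < \<eta>" and near: "\<And>z w. z \<in> cball 0 1 \<Longrightarrow> w \<in> cball 0 1 \<Longrightarrow>
    1 - cmod w < \<eta> \<Longrightarrow> cmod (z - w) < \<eta> \<Longrightarrow> \<kappa> * cmod (z - w) \<le> cmod (\<Psi> z - \<Psi> w)"
    using locally_bounded_below_near_circle[OF m rad] by metis
  define \<theta> where "\<theta> = min \<eta> (sqrt \<epsilon> * \<eta>)"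
  have "0 < \<theta>" using \<eta> \<epsilon> by (simp add: \<theta>_def)
  then obtain \<mu> where \<mu>: "0 < \<mu>"
    "\<forall>z\<in>cball 0 1. \<forall>w\<in>cball 0 1. \<theta> \<le> cmod (z - w) \<longrightarrow> \<mu> \<le> cmod (\<Psi> z - \<Psi> w)"
    using dist_image_bounded_below by blast
  define \<delta> where "\<delta> = min ((\<mu> / 2)\<^sup>2) (\<epsilon> / (1 / \<kappa> * K)\<^sup>2)"
  have "codist (\<Psi> z) (\<Psi> w) \<le> 1 - \<delta>" if zw: "z \<in> \<D>" "w \<in> \<D>" and le: "codist z w \<le> 1 - \<epsilon>" for z w
  proof -
    let ?d = "cmod (1 - cnj (\<Psi> z) * \<Psi> w)"
    have zwc: "z \<in> cball 0 1" "w \<in> cball 0 1" using zw by auto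
    note m' = maps_disc[OF zw(1)] maps_disc[OF zw(2)]
    show ?thesis
    proof (cases "\<theta> \<le> cmod (z - w)")
      case True
      then have "\<mu> \<le> cmod (\<Psi> z - \<Psi> w)" using \<mu>(2) zwc by blast
      then have "\<mu> / 2 \<le> cmod (\<Psi> z - \<Psi> w) / ?d"
        using \<mu>(1) cmod_one_minus_cnj_mult_bounds(1,6)[OF m'] by (intro frac_le) auto
      then have "(\<mu> / 2)\<^sup>2 \<le> 1 - codist (\<Psi> z) (\<Psi> w)"
        unfolding one_minus_codist(1)[OF m'] using \<mu>(1) by (intro power_mono) auto
      then show ?thesis by (simp add: \<delta>_def)
    next
      case False
      have "\<epsilon> \<le> (cmod (z - w) / cmod (1 - cnj z * w))\<^sup>2"
        using le one_minus_codist(1)[OF zw] by simp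
      then have "sqrt \<epsilon> \<le> cmod (z - w) / cmod (1 - cnj z * w)"
        by (intro real_le_lsqrt) (auto simp: real_sqrt_le_iff)
      then have "sqrt \<epsilon> * cmod (1 - cnj z * w) \<le> cmod (z - w)"
        using cmod_one_minus_cnj_mult_bounds(1)[OF zw] by (simp add: pos_le_divide_eq)
      moreover have "sqrt \<epsilon> * (1 - cmod w) \<le> sqrt \<epsilon> * cmod (1 - cnj z * w)"
        using cmod_one_minus_cnj_mult_bounds(3)[OF zw] \<epsilon> by (intro mult_left_mono) auto
      ultimately have "sqrt \<epsilon> * (1 - cmod w) < \<theta>" using False by linarith
      then have "sqrt \<epsilon> * (1 - cmod w) < sqrt \<epsilon> * \<eta>" by (simp add: \<theta>_def)
      then have w: "1 - cmod w < \<eta>" using \<epsilon> by simp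
      have "\<kappa> * cmod (z - w) \<le> cmod (\<Psi> z - \<Psi> w)"
        using near[OF zwc w] False by (simp add: \<theta>_def)
      then have "cmod (z - w) \<le> 1 / \<kappa> * cmod (\<Psi> z - \<Psi> w)"
        using \<kappa> by (simp add: field_simps)
      then have "1 - codist z w \<le> (1 / \<kappa> * K)\<^sup>2 * (1 - codist (\<Psi> z) (\<Psi> w))"
        using \<kappa> K zw m' by (intro one_minus_codist_le_mult) auto
      then have "\<epsilon> \<le> (1 - codist (\<Psi> z) (\<Psi> w)) * (1 / \<kappa> * K)\<^sup>2" using le by (simp add: mult.commute)
      moreover have "0 < (1 / \<kappa> * K)\<^sup>2" using \<kappa> K(1) by simp
      ultimately have "\<epsilon> / (1 / \<kappa> * K)\<^sup>2 \<le> 1 - codist (\<Psi> z) (\<Psi> w)" by (simp only: pos_divide_le_eq)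
      then show ?thesis by (simp add: \<delta>_def)
    qed
  qed
  moreover have "0 < \<delta>" using \<mu>(1) \<epsilon> \<kappa> K(1) by (simp add: \<delta>_def)
  ultimately show ?thesis by blast
qed

text \<open>
  Passing from the image back to \<open>lam\<close> uses the Lipschitz bound for separation, where the forward
  direction uses \<open>preserves_separation\<close>.
\<close>
lemma carleson_seq_image_iff:
  assumes m: "0 < m" and rad: "\<And>\<zeta>. \<zeta> \<in> \<T> \<Longrightarrow> m \<le> radial_coeff \<Psi> \<zeta>" and lam: "lam \<in> J \<rightarrow> \<D>"
  shows "carleson_seq J lam \<longleftrightarrow> carleson_seq J (\<lambda>j. \<Psi> (lam j))"
proof -
  obtain c where c: "0 < c" "\<And>z. z \<in> \<D> \<Longrightarrow> c * (1 - (cmod z)\<^sup>2) \<le> 1 - (cmod (\<Psi> z))\<^sup>2"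
    using one_minus_cmod_ge[OF m rad] by metis
  obtain C where C: "0 < C" "\<And>z. z \<in> \<D> \<Longrightarrow> 1 - (cmod (\<Psi> z))\<^sup>2 \<le> C * (1 - (cmod z)\<^sup>2)"
    using one_minus_cmod_le by metis
  obtain K where K: "0 < K"
    "\<And>z w. z \<in> \<D> \<Longrightarrow> w \<in> \<D> \<Longrightarrow> cmod (1 - cnj (\<Psi> z) * \<Psi> w) \<le> K * cmod (1 - cnj z * w)"
    "\<And>z w. z \<in> \<D> \<Longrightarrow> w \<in> \<D> \<Longrightarrow> cmod (1 - cnj z * w) \<le> K * cmod (1 - cnj (\<Psi> z) * \<Psi> w)"
    using cmod_one_minus_cnj_mult_comparable[OF c] by metis
  obtain L where L: "1 \<le> L" "\<And>z w. z \<in> cball 0 1 \<Longrightarrow> w \<in> cball 0 1 \<Longrightarrow> cmod (\<Psi> z - \<Psi> w) \<le> L * cmod (z - w)"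
    using lipschitz by metis
  have D: "lam j \<in> \<D>" if "j \<in> J" for j using lam that by blast
  have "uniformly_separated J lam \<longleftrightarrow> uniformly_separated J (\<lambda>j. \<Psi> (lam j))"
  proof
    show "uniformly_separated J (\<lambda>j. \<Psi> (lam j))" if "uniformly_separated J lam"
    proof (rule uniformly_separated_transfer[OF _ _ _ that])
      show "codist (\<Psi> (lam j)) (\<Psi> (lam k)) \<le> C\<^sup>2 * K\<^sup>2 * codist (lam j) (lam k)" if "j \<in> J" "k \<in> J" for j k
        by (intro codist_le_mult_codist D maps_disc C K that)
      show "\<exists>\<delta>>0. \<forall>j\<in>J. \<forall>k\<in>J. codist (lam j) (lam k) \<le> 1 - \<epsilon> \<longrightarrow>
          codist (\<Psi> (lam j)) (\<Psi> (lam k)) \<le> 1 - \<delta>" if "0 < \<epsilon>" for \<epsilon>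
        using preserves_separation[OF m rad K(1,2) that] D by blast
    qed simp
    show "uniformly_separated J lam" if "uniformly_separated J (\<lambda>j. \<Psi> (lam j))"
    proof (rule uniformly_separated_transfer[OF _ _ _ that])
      show "codist (lam j) (lam k) \<le> (1 / c)\<^sup>2 * K\<^sup>2 * codist (\<Psi> (lam j)) (\<Psi> (lam k))"
        if "j \<in> J" "k \<in> J" for j k
      proof (rule codist_le_mult_codist)
        show "1 - (cmod (lam j))\<^sup>2 \<le> 1 / c * (1 - (cmod (\<Psi> (lam j)))\<^sup>2)"
          using c(1) c(2)[OF D[OF \<open>j \<in> J\<close>]] by (simp add: field_simps)
        show "1 - (cmod (lam k))\<^sup>2 \<le> 1 / c * (1 - (cmod (\<Psi> (lam k)))\<^sup>2)"
          using c(1) c(2)[OF D[OF \<open>k \<in> J\<close>]] by (simp add: field_simps)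
      qed (use D that maps_disc c(1) K in auto)
      show "\<exists>\<delta>>0. \<forall>j\<in>J. \<forall>k\<in>J. codist (\<Psi> (lam j)) (\<Psi> (lam k)) \<le> 1 - \<epsilon> \<longrightarrow>
          codist (lam j) (lam k) \<le> 1 - \<delta>" if \<epsilon>: "0 < \<epsilon>" for \<epsilon>
      proof (intro exI[of _ "\<epsilon> / (L * K)\<^sup>2"] conjI ballI impI)
        have p: "0 < (L * K)\<^sup>2" using L(1) K(1) by simp
        then show "0 < \<epsilon> / (L * K)\<^sup>2" using \<epsilon> by simp
        fix j k assume jk: "j \<in> J" "k \<in> J" and le: "codist (\<Psi> (lam j)) (\<Psi> (lam k)) \<le> 1 - \<epsilon>"
        have "1 - codist (\<Psi> (lam j)) (\<Psi> (lam k)) \<le> (L * K)\<^sup>2 * (1 - codist (lam j) (lam k))"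
        proof (rule one_minus_codist_le_mult)
          show "cmod (\<Psi> (lam j) - \<Psi> (lam k)) \<le> L * cmod (lam j - lam k)"
            using D[OF jk(1)] D[OF jk(2)] by (intro L(2)) auto
          show "cmod (1 - cnj (lam j) * lam k) \<le> K * cmod (1 - cnj (\<Psi> (lam j)) * \<Psi> (lam k))"
            using D jk by (intro K(3))
        qed (use D[OF jk(1)] D[OF jk(2)] maps_disc L(1) K(1) in auto)
        then have "\<epsilon> \<le> (1 - codist (lam j) (lam k)) * (L * K)\<^sup>2"
          using le by (simp add: mult.commute)
        then have "\<epsilon> / (L * K)\<^sup>2 \<le> 1 - codist (lam j) (lam k)" using p by (simp only: pos_divide_le_eq)
        then show "codist (lam j) (lam k) \<le> 1 - \<epsilon> / (L * K)\<^sup>2" by simp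
      qed
    qed simp
  qed
  moreover have "(\<lambda>j. \<Psi> (lam j)) \<in> J \<rightarrow> \<D>" using D maps_disc by blast
  ultimately show ?thesis using lam unfolding carleson_seq_iff_uniformly_separated by blast
qed

text \<open>
  By density of the open disc, the extension that defines the boundary map is \<open>\<Psi>\<close> itself, made
  undefined outside the closed disc.
\<close>
lemma boundary_map_restrict:
  assumes "\<zeta> \<in> \<T>" shows "boundary_map (restrict \<Psi> \<D>) \<zeta> = \<zeta>"
proof -
  let ?P = "\<lambda>E. E \<in> extensional (cball 0 1) \<and> (\<exists>G. homeomorphism (cball 0 1) (cball 0 1) E G) \<and>
    (\<forall>z\<in>\<D>. E z = restrict \<Psi> \<D> z)"
  obtain G where G: "homeomorphism (cball 0 1) (cball 0 1) \<Psi> G" using homeo by blast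
  have "disc_extension (restrict \<Psi> \<D>) = restrict \<Psi> (cball 0 1)"
    unfolding disc_extension_def
  proof (rule the_equality)
    have "homeomorphism (cball 0 1) (cball 0 1) (restrict \<Psi> (cball 0 1)) G"
      using G by (rule homeomorphism_cong) auto
    then show "?P (restrict \<Psi> (cball 0 1))" by auto
    fix E assume E: "?P E"
    then have contE: "continuous_on (cball 0 1) E" using homeomorphism_cont1 by blast
    have "E z = \<Psi> z" if z: "z \<in> cball 0 1" for z
    proof -
      have "closed {z \<in> cball 0 1. E z - \<Psi> z = 0}"
        by (intro continuous_closed_preimage_constant continuous_intros contE cont closed_cball)
      moreover have "\<D> \<subseteq> {z \<in> cball 0 1. E z - \<Psi> z = 0}" using E by auto
      ultimately have "closure \<D> \<subseteq> {z \<in> cball 0 1. E z - \<Psi> z = 0}" by (rule closure_minimal[rotated])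
      then show ?thesis using z by auto
    qed
    then show "E = restrict \<Psi> (cball 0 1)" using E by (auto intro!: extensionalityI[of _ "cball 0 1"])
  qed
  then show ?thesis using assms boundary by (simp add: boundary_map_def)
qed

lemma restrict_mem_K_c_iff:
  "restrict \<Psi> \<D> \<in> K_c \<longleftrightarrow> (INF \<zeta>\<in>\<T>. radial_coeff \<Psi> \<zeta>) > 0"
proof
  assume "restrict \<Psi> \<D> \<in> K_c"
  then obtain c where "0 < c" "\<And>z. z \<in> \<D> \<Longrightarrow> c * (1 - (cmod z)\<^sup>2) \<le> 1 - (cmod (\<Psi> z))\<^sup>2"
    unfolding K_c_def P_c_def by auto
  then show "(INF \<zeta>\<in>\<T>. radial_coeff \<Psi> \<zeta>) > 0"
    unfolding INF_radial_coeff_pos_iff using radial_coeff_ge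
    by (metis divide_pos_pos less_le_trans zero_less_numeral)
next
  let ?m = "INF \<zeta>\<in>\<T>. radial_coeff \<Psi> \<zeta>"
  assume m: "?m > 0"
  have "bdd_below (radial_coeff \<Psi> ` \<T>)"
    by (intro bounded_imp_bdd_below compact_imp_bounded compact_continuous_image
        continuous_on_radial_coeff) simp
  then have rad: "?m \<le> radial_coeff \<Psi> \<zeta>" if "\<zeta> \<in> \<T>" for \<zeta> using that by (rule cINF_lower)
  obtain c where c: "0 < c" "\<And>z. z \<in> \<D> \<Longrightarrow> c * (1 - (cmod z)\<^sup>2) \<le> 1 - (cmod (\<Psi> z))\<^sup>2"
    using one_minus_cmod_ge[OF m rad] by metis
  obtain C where C: "0 < C" "\<And>z. z \<in> \<D> \<Longrightarrow> 1 - (cmod (\<Psi> z))\<^sup>2 \<le> C * (1 - (cmod z)\<^sup>2)"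
    using one_minus_cmod_le by metis
  have "restrict \<Psi> \<D> \<in> carleson_equiv_maps"
    unfolding carleson_equiv_maps_def
  proof (intro CollectI conjI allI impI)
    show "restrict \<Psi> \<D> \<in> \<D> \<rightarrow> \<D>" using maps_disc by auto
    have "continuous_on \<D> \<Psi>" using cont by (rule continuous_on_subset) auto
    then show "continuous_on \<D> (restrict \<Psi> \<D>)" by (rule continuous_on_eq) simp
    fix J :: "nat set" and lam assume lam: "lam \<in> J \<rightarrow> \<D>"
    have eq: "restrict \<Psi> \<D> (lam j) = \<Psi> (lam j)" if "j \<in> J" for j using lam that by auto
    have "carleson_seq J (\<lambda>j. restrict \<Psi> \<D> (lam j)) \<longleftrightarrow> carleson_seq J (\<lambda>j. \<Psi> (lam j))"
      unfolding carleson_seq_def using eq by (simp add: Pi_iff cong: ball_cong)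
    then show "carleson_seq J lam \<longleftrightarrow> carleson_seq J (\<lambda>j. restrict \<Psi> \<D> (lam j))"
      using carleson_seq_image_iff[OF m rad lam] by simp
  qed
  moreover have "\<exists>c C. 0 < c \<and> c \<le> C \<and> (\<forall>z\<in>\<D>. c * (1 - (cmod z)\<^sup>2) \<le> 1 - (cmod (restrict \<Psi> \<D> z))\<^sup>2 \<and>
      1 - (cmod (restrict \<Psi> \<D> z))\<^sup>2 \<le> C * (1 - (cmod z)\<^sup>2))"
  proof (intro exI conjI ballI)
    fix z assume z: "z \<in> \<D>"
    have "C * (1 - (cmod z)\<^sup>2) \<le> max c C * (1 - (cmod z)\<^sup>2)"
      using one_minus_cmod_sq_pos[OF z] by (intro mult_right_mono) auto
    then show "1 - (cmod (restrict \<Psi> \<D> z))\<^sup>2 \<le> max c C * (1 - (cmod z)\<^sup>2)" using C(2)[OF z] z by simp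
    show "c * (1 - (cmod z)\<^sup>2) \<le> 1 - (cmod (restrict \<Psi> \<D> z))\<^sup>2" using c(2)[OF z] z by simp
  qed (use c(1) in auto)
  ultimately show "restrict \<Psi> \<D> \<in> K_c"
    unfolding K_c_def P_c_def using boundary_map_restrict by blast
qed

end

theorem corollary3p10:
  fixes \<Psi> :: "complex \<Rightarrow> complex"
  assumes "\<exists>G. homeomorphism (cball 0 1) (cball 0 1) \<Psi> G"
    and "C1_closed_disc \<Psi>"
    and "\<forall>\<zeta>\<in>\<T>. \<Psi> \<zeta> = \<zeta>"
  shows "(restrict \<Psi> \<D> \<in> K_c \<longleftrightarrow> (INF \<zeta>\<in>\<T>. radial_coeff \<Psi> \<zeta>) > 0) \<and>
    ((INF \<zeta>\<in>\<T>. radial_coeff \<Psi> \<zeta>) > 0 \<longleftrightarrow> (\<forall>\<zeta>\<in>\<T>. det (real_matrix (D_disc \<Psi> \<zeta>)) > 0))"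
proof -
  obtain U F and D :: "complex \<Rightarrow> complex \<Rightarrow>\<^sub>L complex"
    where U: "cball 0 1 \<subseteq> U" and F: "\<forall>z\<in>cball 0 1. F z = \<Psi> z"
      and D: "\<forall>z\<in>U. (F has_derivative blinfun_apply (D z)) (at z)" "continuous_on U D"
    using assms(2) unfolding C1_closed_disc_def by metis
  interpret C1_disc_homeo \<Psi> F D
    using assms(1,3) U F D by unfold_locales (auto intro: continuous_on_subset)
  show ?thesis
    unfolding restrict_mem_K_c_iff INF_radial_coeff_pos_iff using det_D_disc by simp
qed

end
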